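(* Let $\varepsilon \in \{-1,1\}$, $\lambda = (\lambda_1,\dots,\lambda_\ell)\in\mathbb{Z}_{>0}^\ell$, $d=\lambda_1+\dots+\lambda_\ell$, $s(j)=\lambda_1+\dots+\lambda_{j-1}$. For $\boldsymbol{n}\in\mathbb{Z}^d$ and $k \in \mathbb{Z}$ let $$A_\lambda(\boldsymbol{n};k)=\prod_{j=1}^{\ell} \binom{n_{s(j)+1}+\dots+n_{s(j)+\lambda_j} - (\lambda_j-1)k}{n_{s(j)+1}-k,\ \dots,\ n_{s(j)+\lambda_j}-k,\ k}, \qquad A_{\lambda,\varepsilon}(\boldsymbol{n}) = \sum_{k\in\mathbb{Z}} \varepsilon^k A_\lambda(\boldsymbol{n};k),$$ and suppose $\boldsymbol{n} \in \mathbb{Z}^d$ is such that this sum has only finitely many nonzero terms for $\boldsymbol{n}$ (and hence for every $m\boldsymbol{n}$, $m\ge1$ considered below, the finiteness being assumed for $p^r\boldsymbol n$ and $p^{r-1}\boldsymbol n$). (a) If $\ell \ge 2$, then for all primes $p \ge 3$ and integers $r\ge1$, $A_{\lambda,\varepsilon}(p^r\boldsymbol{n}) \equiv A_{\lambda,\varepsilon}(p^{r-1}\boldsymbol{n}) \pmod{p^{2r}}$. If $\varepsilon=1$, this also holds for $p=2$. (b) If $\ell\ge2$ and $\max(\lambda_1,\dots,\lambda_\ell)\le 2$, then for all primes $p\ge5$ and integers $r\ge1$, $A_{\lambda,\varepsilon}(p^r\boldsymbol{n}) \equiv A_{\lambda,\varepsilon}(p^{r-1}\boldsymbol{n}) 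\pmod{p^{3r}}$.
   Context: For all integers $n, k$, the binomial coefficient is defined by $\binom{n}{k} = \lim_{z \to 0} \frac{\Gamma(z+n+1)}{\Gamma(z+k+1)\Gamma(z+n-k+1)}$; this is a finite integer for all $n,k\in\mathbb{Z}$, agrees with the usual one for $n\ge0$, and satisfies $\binom{n}{k}=\binom{n}{n-k}$. For integers $m_1,\dots,m_\rho,k$ the multinomial coefficient with integer entries is defined as the product of such binomial coefficients $$\binom{m_1+\dots+m_\rho-(\rho-1)k}{m_1-k,\dots,m_\rho-k,k} := \prod_{i=1}^{\rho}\binom{m_1+\dots+m_i-(i-1)k}{m_i-k},$$ which agrees with the usual multinomial coefficient when all entries are nonnegative (the $i=1$ factor is $\binom{m_1}{k}$; for $\rho=2$ the product is $\binom{m_1}{k}\binom{m_1+m_2-k}{m_1}$). For $\boldsymbol n\in\mathbb{Z}_{\ge0}^d$, $A_{\lambda,\varepsilon}(\boldsymbol n)$ is the coefficient of $x_1^{n_1}\cdots x_d^{n_d}$ in $\big(\prod_{j=1}^\ell[1-\sum_{r=1}^{\lambda_j}x_{s(j)+r}]-\varepsilon x_1\cdots x_d\big)^{-1}$. *)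

theory Defs
  imports "HOL-Analysis.Analysis"
begin

definition gbinom :: "int \<Rightarrow> int \<Rightarrow> real" where
  "gbinom n k = Lim (at (0::real))
     (\<lambda>z. Gamma (z + of_int n + 1) / (Gamma (z + of_int k + 1) * Gamma (z + of_int n - of_int k + 1)))"

definition gmultinom :: "int list \<Rightarrow> int \<Rightarrow> real" where
  "gmultinom ms k = (\<Prod>i<length ms. gbinom (sum_list (take (Suc i) ms) - int i * k) (ms ! i - k))"

definition blockstart :: "nat list \<Rightarrow> nat \<Rightarrow> nat" where
  "blockstart lam j = sum_list (take j lam)"

text \<open>A_lambda(n;k); the vector n in Z^d is given as n 0, ..., n (d-1).\<close>
definition A_lam :: "nat list \<Rightarrow> (nat \<Rightarrow> int) \<Rightarrow> int \<Rightarrow> real" where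
  "A_lam lam n k = (\<Prod>j<length lam.
      gmultinom (map (\<lambda>r. n (blockstart lam j + r)) [0..<lam ! j]) k)"

definition A_support :: "nat list \<Rightarrow> (nat \<Rightarrow> int) \<Rightarrow> int set" where
  "A_support lam n = {k. A_lam lam n k \<noteq> 0}"

definition A_lam_eps :: "nat list \<Rightarrow> int \<Rightarrow> (nat \<Rightarrow> int) \<Rightarrow> real" where
  "A_lam_eps lam eps n = (\<Sum>k\<in>A_support lam n. (real_of_int eps) powi k * A_lam lam n k)"

end

theory Submission
  imports Defs "HOL-Number_Theory.Number_Theory"
begin

text \<open>
  For \<open>0 \<le> m\<close>, cancelling the multiples of \<open>p\<close> in \<open>binom(pQ + m, m) = \<Prod>\<^sub>j (pQ + j)/j\<close> leaves
  \<open>binom(Q + m div p, m div p)\<close> times \<open>\<Prod> (pQ + j)/j\<close> over the \<open>j \<le> m\<close> prime to \<open>p\<close>; symmetry and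
  negation of the upper entry reduce all integer entries to this case. With \<open>D = pQ\<close>, \<open>N = m\<close>, pairing
  \<open>j\<close> with \<open>N - j\<close> turns the numerators into \<open>j(N - j) + D(D + N)\<close>. Hence the ratio is \<open>1\<close> modulo
  \<open>p\<^sup>2\<^sup>s\<close> when \<open>p\<^sup>s\<close> divides all entries, and since \<open>\<Sum> 1/j\<^sup>2\<close> vanishes modulo \<open>p\<^sup>s\<close> for \<open>p \<ge> 5\<close>, the
  ratio is \<open>1\<close> modulo \<open>p\<^bsup>r + 2s\<^esup>\<close> when moreover the upper entry or \<open>D\<close> is divisible by \<open>p\<^sup>r\<close>.

  Each block of \<open>A(p\<^sup>r n; k)\<close> contributes a factor \<open>p\<^bsup>r - s\<^esup>\<close>, where \<open>s\<close> is the exponent of \<open>p\<close> in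
  \<open>k\<close>. Together with the ratio congruences this compares the terms \<open>pk\<close> and \<open>k\<close> one by one, and it
  settles the remaining terms except for the cube congruence with exactly two blocks. There the terms
  with \<open>p\<close> not dividing \<open>k\<close> are, modulo \<open>p\<^sup>3\<^sup>r\<close>, equal to
  \<open>p\<^sup>2\<^sup>r \<epsilon>\<^sup>k k\<^sup>-\<^sup>2 G\<^sub>r(k - 1)\<close>, where \<open>G\<^sub>i(K) \<equiv> G\<^sub>i\<^sub>-\<^sub>1(K div p)\<close> modulo \<open>p\<^sup>i\<close>; summing
  over blocks of length \<open>p, p\<^sup>2, \<dots>, p\<^sup>r\<close>, on which the weights \<open>\<epsilon>\<^sup>k k\<^sup>-\<^sup>2\<close> add up to \<open>0\<close> modulo the length,
  gives the missing \<open>p\<^sup>r\<close>.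
\<close>

section \<open>Binomial coefficients with integer entries\<close>

text \<open>Taken from the real-valued \<open>gchoose\<close>, whose identities hold for every upper
  entry. The values at integers are integers, so the floor changes nothing.\<close>

definition ichoose :: "int \<Rightarrow> nat \<Rightarrow> int" where
  "ichoose n m = \<lfloor>real_of_int n gchoose m\<rfloor>"

lemma of_int_ichoose: "real_of_int (ichoose n m) = real_of_int n gchoose m"
  unfolding ichoose_def of_int_gbinomial[symmetric] floor_of_int ..

lemma ichoose_0 [simp]: "ichoose n 0 = 1"
  by (simp add: ichoose_def)

text \<open>The middle branch is the mirror image of the first under \<open>k\<close> to
  \<open>n - k\<close>. In the last one the Gamma quotient has one pole above and two below, so its
  limit is 0.\<close>

definition ibinom :: "int \<Rightarrow> int \<Rightarrow> int" where
  "ibinom n k = (if 0 \<le> k then ichoose n (nat k)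
     else if k \<le> n then ichoose n (nat (n - k)) else 0)"

section \<open>Evaluation of the Gamma limit\<close>

lemma shifted_notin_nonpos_Ints:
  fixes z :: real
  assumes "z \<noteq> 0" "\<bar>z\<bar> < 1"
  shows "z + of_int m \<notin> \<int>\<^sub>\<le>\<^sub>0"
proof
  assume "z + of_int m \<in> \<int>\<^sub>\<le>\<^sub>0"
  then obtain i :: int where "z + of_int m = of_int i"
    by (auto elim!: nonpos_Ints_cases)
  then have z: "z = of_int (i - m)" by simp
  with assms have "i - m \<noteq> 0" "\<bar>i - m\<bar> < 1" by linarith+
  then show False by simp
qed

lemma eventually_at_0_small: "\<forall>\<^sub>F z in at (0::real). z \<noteq> 0 \<and> \<bar>z\<bar> < 1"
  unfolding eventually_at by (rule exI[of _ 1]) (auto simp: dist_real_def)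

lemma tendsto_pochhammer:
  fixes f :: "'b \<Rightarrow> 'a::real_normed_field"
  assumes "(f \<longlongrightarrow> a) F"
  shows "((\<lambda>z. pochhammer (f z) m) \<longlongrightarrow> pochhammer a m) F"
  unfolding pochhammer_prod by (intro tendsto_prod tendsto_add assms tendsto_const)

text \<open>Near 0 two of the Gamma values combine to a Pochhammer symbol, which is a polynomial in
  \<open>z\<close>; the third is continuous at 0 with value \<open>fact m\<close>.\<close>

lemma gbinom_tendsto_nonneg:
  "((\<lambda>z::real. Gamma (z + of_int n + 1) /
       (Gamma (z + of_int (int m) + 1) * Gamma (z + of_int n - of_int (int m) + 1)))
     \<longlongrightarrow> of_int (ichoose n m)) (at 0)"
proof -
  have "((\<lambda>z::real. pochhammer (z + (of_int n - of_nat m + 1)) m / Gamma (z + (of_nat m + 1)))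
      \<longlongrightarrow> pochhammer (0 + (of_int n - of_nat m + 1)) m / Gamma (0 + (of_nat m + 1))) (at 0)"
    by (intro tendsto_divide tendsto_pochhammer tendsto_Gamma tendsto_add tendsto_ident_at tendsto_const)
       (auto simp: Gamma_eq_zero_iff dest!: nonpos_Ints_nonpos)
  also have "pochhammer (0 + (of_int n - of_nat m + 1)) m / Gamma (0 + (of_nat m + 1)) = (of_int (ichoose n m) :: real)"
    by (simp add: of_int_ichoose gbinomial_pochhammer' Gamma_fact add.commute)
  finally show ?thesis
  proof (rule Lim_transform_eventually)
    show "\<forall>\<^sub>F z::real in at 0. pochhammer (z + (of_int n - of_nat m + 1)) m / Gamma (z + (of_nat m + 1)) =
      Gamma (z + of_int n + 1) /
       (Gamma (z + of_int (int m) + 1) * Gamma (z + of_int n - of_int (int m) + 1))"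
      using eventually_at_0_small
    proof eventually_elim
      case (elim z)
      have "z + (of_int n - of_nat m + 1) \<notin> \<int>\<^sub>\<le>\<^sub>0"
        using shifted_notin_nonpos_Ints[of z "n - int m + 1"] elim by simp
      then show ?case
        by (subst pochhammer_Gamma) (simp_all add: algebra_simps)
    qed
  qed
qed

text \<open>With \<open>m = k - n\<close>, two Gamma values leave the reciprocal of a Pochhammer
  symbol whose factors at 0 run from \<open>n + 1\<close> to \<open>k\<close>, all negative. The
  remaining factor is \<open>rGamma\<close> near \<open>1 - m \<le> 0\<close>, where it
  vanishes.\<close>

lemma gbinom_tendsto_neg:
  assumes "k < 0" "n < k"
  shows "((\<lambda>z::real. Gamma (z + of_int n + 1) /
       (Gamma (z + of_int k + 1) * Gamma (z + of_int n - of_int k + 1))) \<longlongrightarrow> 0) (at 0)"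
proof -
  define m where "m = nat (k - n)"
  have k: "k = n + int m" using assms by (simp add: m_def)
  have nz: "pochhammer (0 + (of_int n + 1)) m \<noteq> (0::real)"
  proof
    assume "pochhammer (0 + (of_int n + 1)) m = (0::real)"
    then obtain i where "i < m" "of_int n + 1 = - (of_nat i :: real)"
      by (auto simp: pochhammer_eq_0_iff)
    then have "of_int (n + 1 + int i) = (0::real)" by simp
    then have "n + 1 + int i = 0" by (simp only: of_int_eq_0_iff)
    with \<open>i < m\<close> k assms show False by simp
  qed
  have zero: "rGamma (of_int (1 - int m) :: real) = 0"
    using assms k unfolding rGamma_eq_zero_iff
    by (intro nonpos_Ints_of_int) simp
  have "((\<lambda>z::real. 1 / pochhammer (z + (of_int n + 1)) m * rGamma (z + of_int (1 - int m)))
      \<longlongrightarrow> 1 / pochhammer (0 + (of_int n + 1)) m * rGamma (0 + of_int (1 - int m))) (at 0)"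
    by (intro tendsto_intros tendsto_pochhammer isCont_tendsto_compose[OF isCont_rGamma[OF continuous_ident]] nz)
  also have "1 / pochhammer (0 + (of_int n + 1)) m * rGamma (0 + of_int (1 - int m)) = (0::real)"
    using zero by simp
  finally show ?thesis
  proof (rule Lim_transform_eventually)
    show "\<forall>\<^sub>F z::real in at 0. 1 / pochhammer (z + (of_int n + 1)) m * rGamma (z + of_int (1 - int m)) =
      Gamma (z + of_int n + 1) / (Gamma (z + of_int k + 1) * Gamma (z + of_int n - of_int k + 1))"
      using eventually_at_0_small
    proof eventually_elim
      case (elim z)
      have "z + (of_int n + 1) \<notin> \<int>\<^sub>\<le>\<^sub>0"
        using shifted_notin_nonpos_Ints[of z "n + 1"] elim by simp
      then show ?case
        by (subst pochhammer_Gamma) (simp_all add: algebra_simps k rGamma_inverse_Gamma divide_simps)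
    qed
  qed
qed

lemma gbinom_eq_ibinom: "gbinom n k = of_int (ibinom n k)"
proof -
  consider "k \<ge> 0" | "k < 0" "k \<le> n" | "k < 0" "n < k" by linarith
  then have "((\<lambda>z::real. Gamma (z + of_int n + 1) /
       (Gamma (z + of_int k + 1) * Gamma (z + of_int n - of_int k + 1)))
     \<longlongrightarrow> of_int (ibinom n k)) (at 0)"
  proof cases
    case 1
    then show ?thesis using gbinom_tendsto_nonneg[of n "nat k"] by (simp add: ibinom_def)
  next
    case 2
    then show ?thesis using gbinom_tendsto_nonneg[of n "nat (n - k)"]
      by (simp add: ibinom_def algebra_simps)
  next
    case 3
    then show ?thesis using gbinom_tendsto_neg[of k n] by (simp add: ibinom_def)
  qed
  then show ?thesis
    unfolding gbinom_def by (rule tendsto_Lim[OF trivial_limit_at])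
qed

section \<open>Symmetry, absorption and negation for all integer entries\<close>

lemma ichoose_of_nat: "0 \<le> n \<Longrightarrow> ichoose n m = int (nat n choose m)"
  using binomial_gbinomial[of "nat n" m, where 'a = real]
  by (metis floor_of_nat ichoose_def int_nat_eq of_int_of_nat_eq)

lemma ichoose_eq_0: "0 \<le> n \<Longrightarrow> n < int m \<Longrightarrow> ichoose n m = 0"
  by (simp add: ichoose_of_nat binomial_eq_0)

lemma ichoose_symmetric:
  assumes "0 \<le> k" "k \<le> n"
  shows "ichoose n (nat k) = ichoose n (nat (n - k))"
  using assms by (simp add: ichoose_of_nat binomial_symmetric[of "nat k" "nat n"] nat_diff_distrib)

lemma ibinom_0 [simp]: "ibinom n 0 = 1"
  by (simp add: ibinom_def)

lemma ibinom_eq_0: "k < 0 \<Longrightarrow> n < k \<Longrightarrow> ibinom n k = 0"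
  by (simp add: ibinom_def)

lemma ibinom_eq_0': "0 \<le> n \<Longrightarrow> n < k \<Longrightarrow> ibinom n k = 0"
  by (simp add: ibinom_def ichoose_eq_0)

lemma ibinom_sym: "ibinom n (n - k) = ibinom n k"
proof -
  consider "0 \<le> k" "k \<le> n" | "0 \<le> k" "n < k" "0 \<le> n" | "0 \<le> k" "n < 0"
    | "k < 0" "k \<le> n" | "k < 0" "n < k" by linarith
  then show ?thesis
  proof cases
    case 1
    then show ?thesis using ichoose_symmetric[of k n] by (simp add: ibinom_def)
  qed (auto simp: ibinom_def ichoose_eq_0)
qed

lemma ichoose_absorption: "int (Suc m) * ichoose n (Suc m) = n * ichoose (n - 1) m"
proof -
  have "real_of_int (int (Suc m) * ichoose n (Suc m)) = of_int (n * ichoose (n - 1) m)"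
    using gbinomial_absorption[of m "real_of_int n"] by (simp add: of_int_ichoose)
  then show ?thesis by (simp only: of_int_eq_iff)
qed

lemma ichoose_absorb_comp: "(n - int m) * ichoose n m = n * ichoose (n - 1) m"
proof -
  have "real_of_int ((n - int m) * ichoose n m) = of_int (n * ichoose (n - 1) m)"
    using gbinomial_absorb_comp[of "real_of_int n" m] by (simp add: of_int_ichoose)
  then show ?thesis by (simp only: of_int_eq_iff)
qed

text \<open>For \<open>k < 0\<close> and \<open>k \<le> n\<close> the value is an
  \<open>ichoose\<close> with lower entry \<open>n - k\<close>, so there the complementary
  absorption law takes the place of the usual one.\<close>

lemma ibinom_absorb: "k * ibinom n k = n * ibinom (n - 1) (k - 1)"
proof -
  consider "0 < k" | "k = 0" | "k < 0" "k \<le> n" | "k < 0" "n < k" by linarith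
  then show ?thesis
  proof cases
    case 1
    then obtain m where "k = int (Suc m)"
      by (metis Suc_pred zero_less_imp_eq_int)
    then show ?thesis
      using ichoose_absorption[of m n] by (simp add: ibinom_def nat_add_distrib)
  next
    case 2
    then show ?thesis by (cases "n < 0"; cases "n = 0") (auto simp: ibinom_def ichoose_eq_0)
  next
    case 3
    then show ?thesis
      using ichoose_absorb_comp[of n "nat (n - k)"] by (simp add: ibinom_def)
  qed (simp add: ibinom_def)
qed

lemma ibinom_absorb_comp: "(n - k) * ibinom n k = n * ibinom (n - 1) k"
  using ibinom_absorb[of "n - k" n] ibinom_sym[of n k] ibinom_sym[of "n - 1" k]
  by (simp add: algebra_simps)

lemma ibinom_negate_upper:
  assumes "0 \<le> k"
  shows "ibinom n k = (-1) ^ nat k * ibinom (k - n - 1) k"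
proof -
  have "real_of_int (ichoose n (nat k)) = of_int ((-1) ^ nat k * ichoose (k - n - 1) (nat k))"
    using gbinomial_negated_upper[of "real_of_int n" "nat k"] assms by (simp add: of_int_ichoose)
  then have "ichoose n (nat k) = (-1) ^ nat k * ichoose (k - n - 1) (nat k)"
    by (simp only: of_int_eq_iff)
  with assms show ?thesis by (simp add: ibinom_def)
qed

section \<open>Ratios of binomial coefficients modulo prime powers\<close>

text \<open>For \<open>D = p * Q\<close> these are the factors prime to \<open>p\<close> in the
  numerator of \<open>ibinom (D + m) m\<close>; \<open>D = 0\<close> gives those of the
  denominator.\<close>

definition unitprod :: "int \<Rightarrow> int \<Rightarrow> int \<Rightarrow> int" where
  "unitprod p D m = (\<Prod>j | j \<in> {1..m} \<and> \<not> p dvd j. D + j)"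

lemma unitprod_0 [simp]: "unitprod p D 0 = 1"
  by (simp add: unitprod_def)

lemma unitprod_step:
  assumes "0 \<le> m"
  shows "unitprod p D (m + 1) = (if p dvd m + 1 then 1 else D + (m + 1)) * unitprod p D m"
proof (cases "p dvd m + 1")
  case True
  then have "{j \<in> {1..m + 1}. \<not> p dvd j} = {j \<in> {1..m}. \<not> p dvd j}"
    by (auto simp: order_le_less)
  then show ?thesis using True by (simp add: unitprod_def)
next
  case False
  then have *: "{j \<in> {1..m + 1}. \<not> p dvd j} = insert (m + 1) {j \<in> {1..m}. \<not> p dvd j}"
    using assms by auto
  have "finite {j \<in> {1..m}. \<not> p dvd j}" by (rule finite_subset[of _ "{1..m}"]) auto
  then show ?thesis using False unfolding unitprod_def * by (subst prod.insert) auto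
qed

text \<open>Induction on \<open>m\<close> by absorption. If \<open>p\<close> does not divide
  \<open>m + 1\<close>, the quotient \<open>m div p\<close> stays and the new factors enter the unit
  products; otherwise the unit products stay, and after cancelling \<open>p\<close> the new factor
  is the one that absorption gives for the small coefficient.\<close>

lemma ibinom_core:
  fixes p Q m :: int
  assumes p: "1 < p" and m: "0 \<le> m"
  shows "unitprod p 0 m * ibinom (p * Q + m) m =
         unitprod p (p * Q) m * ibinom (Q + m div p) (m div p)"
  using m
proof (induction m rule: int_ge_induct)
  case base
  then show ?case by simp
next
  case (step m)
  have abs: "(m + 1) * ibinom (p * Q + (m + 1)) (m + 1) = (p * Q + (m + 1)) * ibinom (p * Q + m) m"
    using ibinom_absorb[of "m + 1" "p * Q + (m + 1)"] by (simp add: algebra_simps)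
  show ?case
  proof (cases "p dvd m + 1")
    case False
    have "m mod p + 1 \<noteq> p"
    proof
      assume "m mod p + 1 = p"
      then have "m + 1 = p * (m div p + 1)"
        by (metis add.assoc distrib_left mult.right_neutral mult_div_mod_eq)
      with False show False by simp
    qed
    then have "m mod p + 1 < p" using pos_mod_bound[of p m] p by linarith
    moreover have "m + 1 = p * (m div p) + (m mod p + 1)" by simp
    moreover have "0 \<le> m mod p + 1" using p by (simp add: add_nonneg_nonneg)
    ultimately have d: "(m + 1) div p = m div p" by (intro int_div_pos_eq)
    have "unitprod p 0 (m + 1) * ibinom (p * Q + (m + 1)) (m + 1) =
        unitprod p 0 m * ((m + 1) * ibinom (p * Q + (m + 1)) (m + 1))"
      using False step.hyps by (simp add: unitprod_step)
    also have "\<dots> = (p * Q + (m + 1)) * (unitprod p 0 m * ibinom (p * Q + m) m)"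
      unfolding abs by (simp only: mult.left_commute)
    also have "\<dots> = unitprod p (p * Q) (m + 1) * ibinom (Q + m div p) (m div p)"
      unfolding step.IH using False step.hyps by (simp add: unitprod_step mult.assoc)
    finally show ?thesis unfolding d .
  next
    case True
    then obtain v where v: "m + 1 = p * v" by blast
    have "0 < p * v" using v step.hyps by linarith
    then have v0: "v > 0" using p by (simp add: zero_less_mult_iff)
    have mv: "m = p * (v - 1) + (p - 1)" using v by (simp add: algebra_simps)
    have d: "m div p = v - 1" using p unfolding mv by simp
    have d': "(m + 1) div p = v" using p unfolding v by simp
    have "p * (v * ibinom (p * Q + (m + 1)) (m + 1)) = p * ((Q + v) * ibinom (p * Q + m) m)"
      using abs unfolding v by (simp add: algebra_simps)
    then have 1: "v * ibinom (p * Q + (m + 1)) (m + 1) = (Q + v) * ibinom (p * Q + m) m"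
      using p by simp
    have 2: "v * ibinom (Q + v) v = (Q + v) * ibinom (Q + v - 1) (v - 1)"
      by (rule ibinom_absorb)
    have "v * (unitprod p 0 m * ibinom (p * Q + (m + 1)) (m + 1)) =
          (Q + v) * (unitprod p 0 m * ibinom (p * Q + m) m)"
      using 1 by (simp add: mult.left_commute)
    also have "\<dots> = unitprod p (p * Q) m * ((Q + v) * ibinom (Q + v - 1) (v - 1))"
      using step.IH d by (simp add: algebra_simps)
    also have "\<dots> = v * (unitprod p (p * Q) m * ibinom (Q + v) v)"
      using 2 by (simp add: mult.left_commute)
    finally show ?thesis
      using v0 True step.hyps by (simp add: unitprod_step d')
  qed
qed

section \<open>Quotients congruent to 1\<close>

text \<open>Says that \<open>x / y\<close> is 1 modulo \<open>p ^ e\<close> among fractions with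
  denominator prime to \<open>p\<close>. The cross-multiplied form also covers \<open>y = 0\<close>,
  where it forces \<open>x = 0\<close>.\<close>

definition pratio :: "int \<Rightarrow> nat \<Rightarrow> int \<Rightarrow> int \<Rightarrow> bool" where
  "pratio p e x y \<longleftrightarrow> (\<exists>X Y. \<not> p dvd Y \<and> Y * x = X * y \<and> p ^ e dvd X - Y)"

lemma pratioI: "\<not> p dvd Y \<Longrightarrow> Y * x = X * y \<Longrightarrow> p ^ e dvd X - Y \<Longrightarrow> pratio p e x y"
  unfolding pratio_def by blast

lemma pratio_refl: "1 < p \<Longrightarrow> pratio p e x x"
  by (rule pratioI[of p 1 x 1]) (auto simp: zdvd_not_zless)

lemma pratio_mult:
  assumes "prime p" "pratio p e x y" "pratio p e x' y'"
  shows "pratio p e (x * x') (y * y')"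
proof -
  obtain X Y X' Y' where *: "\<not> p dvd Y" "Y * x = X * y" "p ^ e dvd X - Y"
    "\<not> p dvd Y'" "Y' * x' = X' * y'" "p ^ e dvd X' - Y'"
    using assms unfolding pratio_def by blast
  show ?thesis
  proof (rule pratioI)
    show "\<not> p dvd Y * Y'" using * assms(1) by (simp add: prime_dvd_mult_iff)
    show "Y * Y' * (x * x') = X * X' * (y * y')" using *(2,5) by (metis mult.left_commute mult.assoc)
    have "X * X' - Y * Y' = X * (X' - Y') + (X - Y) * Y'" by (simp add: algebra_simps)
    then show "p ^ e dvd X * X' - Y * Y'" using *(3,6) by (metis dvd_add dvd_mult dvd_mult2)
  qed
qed

lemma pratio_prod:
  assumes "prime (p::int)" "\<And>i. i \<in> I \<Longrightarrow> pratio p e (f i) (g i)"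
  shows "pratio p e (\<Prod>i\<in>I. f i) (\<Prod>i\<in>I. g i)"
  using assms(2)
proof (induction I rule: infinite_finite_induct)
  case (insert i I)
  then show ?case using assms(1) by (simp add: pratio_mult)
qed (auto intro: pratio_refl prime_gt_1_int assms(1))

lemma prime_power_dvd_cancel:
  fixes p :: int
  assumes "prime p" "\<not> p dvd Y" "p ^ e dvd Y * x"
  shows "p ^ e dvd x"
  using assms by (metis coprime_dvd_mult_right_iff coprime_power_left_iff prime_imp_coprime)

text \<open>From \<open>Y * (x - y) = (X - Y) * y\<close>: the power of \<open>p\<close> in
  \<open>y\<close> adds to the precision of the ratio.\<close>

lemma pratio_dvd_diff:
  assumes "prime p" "pratio p e x y" "p ^ t dvd y"
  shows "p ^ (e + t) dvd x - y"
proof -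
  obtain X Y where *: "\<not> p dvd Y" "Y * x = X * y" "p ^ e dvd X - Y"
    using assms unfolding pratio_def by blast
  have "Y * (x - y) = (X - Y) * y" using * by (simp add: algebra_simps)
  then have "p ^ (e + t) dvd Y * (x - y)"
    using *(3) assms(3) by (simp add: power_add mult_dvd_mono)
  then show ?thesis using prime_power_dvd_cancel assms(1) *(1) by blast
qed

section \<open>Pairing \<open>j\<close> with \<open>N - j\<close>\<close>

definition halfunits :: "int \<Rightarrow> int \<Rightarrow> int set" where
  "halfunits p N = {j. 0 < j \<and> 2 * j < N \<and> \<not> p dvd j}"

lemma finite_halfunits [simp]: "finite (halfunits p N)"
  by (rule finite_subset[of _ "{0..N}"]) (auto simp: halfunits_def)

text \<open>The involution \<open>j\<close> to \<open>N - j\<close> has no fixed point prime to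
  \<open>p\<close>: from \<open>2 * j = N\<close> follows \<open>p dvd j\<close>, for odd
  \<open>p\<close> by cancelling 2 and for \<open>p = 2\<close> from \<open>4 dvd N\<close>.\<close>

lemma units_eq_halfunits:
  assumes "prime p" "p dvd N" "odd p \<or> 4 dvd N"
  shows "{j \<in> {1..N}. \<not> p dvd j} = halfunits p N \<union> (\<lambda>j. N - j) ` halfunits p N"
proof (intro equalityI subsetI)
  fix j assume j: "j \<in> {j \<in> {1..N}. \<not> p dvd j}"
  have "2 * j \<noteq> N"
  proof
    assume N: "2 * j = N"
    then have "p dvd 2 * j" using assms(2) by simp
    then have "p dvd 2" using j assms(1) by (simp add: prime_dvd_mult_iff)
    then have "p = 2" using assms(1) by (simp add: primes_dvd_imp_eq)
    moreover from this have "even j" using assms(3) N by presburger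
    ultimately show False using j by simp
  qed
  moreover have "j \<noteq> N" using j assms(2) by auto
  moreover have "\<not> p dvd N - j" using j assms(2) by (simp add: dvd_diff_right_iff)
  ultimately have "j \<in> halfunits p N \<or> N - j \<in> halfunits p N"
    using j by (auto simp: halfunits_def)
  then show "j \<in> halfunits p N \<union> (\<lambda>j. N - j) ` halfunits p N"
    by (metis UnI1 UnI2 diff_diff_eq2 add_diff_cancel_left' image_eqI)
next
  fix j assume "j \<in> halfunits p N \<union> (\<lambda>j. N - j) ` halfunits p N"
  then show "j \<in> {j \<in> {1..N}. \<not> p dvd j}"
    using assms(2) by (auto simp: halfunits_def dvd_diff_right_iff)
qed

lemma prod_units_halfunits:
  fixes f :: "int \<Rightarrow> 'a::comm_monoid_mult"
  assumes "prime p" "p dvd N" "odd p \<or> 4 dvd N"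
  shows "(\<Prod>j | j \<in> {1..N} \<and> \<not> p dvd j. f j) = (\<Prod>j\<in>halfunits p N. f j * f (N - j))"
proof -
  have "(\<Prod>j | j \<in> {1..N} \<and> \<not> p dvd j. f j) =
        (\<Prod>j\<in>halfunits p N. f j) * (\<Prod>j\<in>(\<lambda>j. N - j) ` halfunits p N. f j)"
    unfolding units_eq_halfunits[OF assms]
    by (rule prod.union_disjoint) (simp, simp, auto simp: halfunits_def)
  also have "(\<Prod>j\<in>(\<lambda>j. N - j) ` halfunits p N. f j) = (\<Prod>j\<in>halfunits p N. f (N - j))"
    by (subst prod.reindex) (auto simp: inj_on_def)
  finally show ?thesis by (simp add: prod.distrib)
qed

lemma unitprod_halfunits:
  assumes "prime p" "p dvd N" "odd p \<or> 4 dvd N"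
  shows "unitprod p D N = (\<Prod>j\<in>halfunits p N. j * (N - j) + D * (D + N))"
  unfolding unitprod_def prod_units_halfunits[OF assms]
  by (rule prod.cong) (auto simp: algebra_simps)

lemma unitprod_0_not_dvd:
  assumes "prime p"
  shows "\<not> p dvd unitprod p 0 m"
proof -
  have "finite {j \<in> {1..m}. \<not> p dvd j}" by (rule finite_subset[of _ "{1..m}"]) auto
  then show ?thesis using assms unfolding unitprod_def by (simp add: prime_dvd_prod_iff)
qed

lemma prod_add_cong:
  fixes a :: "'b \<Rightarrow> int"
  shows "D dvd (\<Prod>j\<in>J. a j + D) - (\<Prod>j\<in>J. a j)"
proof -
  have "[(\<Prod>j\<in>J. a j + D) = (\<Prod>j\<in>J. a j)] (mod D)"
    by (rule cong_prod) (simp add: cong_def)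
  then show ?thesis by (simp add: cong_iff_dvd_diff)
qed

text \<open>First-order expansion in \<open>D\<close>; the linear coefficient is the elementary
  symmetric polynomial of degree \<open>card J - 1\<close>.\<close>

lemma prod_add_cong2:
  fixes a :: "'b \<Rightarrow> int"
  assumes "finite J"
  shows "D ^ 2 dvd (\<Prod>j\<in>J. a j + D) - (\<Prod>j\<in>J. a j) - D * (\<Sum>j\<in>J. \<Prod>i\<in>J - {j}. a i)"
  using assms
proof (induction J rule: finite_induct)
  case (insert x J)
  define P where "P = (\<Prod>j\<in>J. a j)"
  define P' where "P' = (\<Prod>j\<in>J. a j + D)"
  define S where "S = (\<Sum>j\<in>J. \<Prod>i\<in>J - {j}. a i)"
  have "(\<Sum>j\<in>J. \<Prod>i\<in>insert x J - {j}. a i) = (\<Sum>j\<in>J. a x * (\<Prod>i\<in>J - {j}. a i))"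
  proof (rule sum.cong[OF refl])
    fix j assume "j \<in> J"
    then have "insert x J - {j} = insert x (J - {j})" using insert.hyps by auto
    then show "(\<Prod>i\<in>insert x J - {j}. a i) = a x * (\<Prod>i\<in>J - {j}. a i)"
      using insert.hyps by simp
  qed
  then have S': "(\<Sum>j\<in>insert x J. \<Prod>i\<in>insert x J - {j}. a i) = P + a x * S"
    using insert.hyps by (simp add: P_def S_def sum_distrib_left)
  have IH: "D ^ 2 dvd P' - P - D * S" using insert.IH by (simp add: P_def P'_def S_def)
  have "D dvd P' - P" unfolding P_def P'_def by (rule prod_add_cong)
  then have "D ^ 2 dvd D * (P' - P)" by (simp add: power2_eq_square)
  then have "D ^ 2 dvd a x * (P' - P - D * S) + D * (P' - P)"
    using IH by (simp only: dvd_add dvd_mult)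
  also have "a x * (P' - P - D * S) + D * (P' - P) = (a x + D) * P' - a x * P - D * (P + a x * S)"
    by (simp add: algebra_simps)
  finally show ?case unfolding S' using insert.hyps by (simp add: P_def P'_def)
qed simp

lemma unitprod_cong_pair:
  assumes "prime p" "p dvd N" "odd p \<or> 4 dvd N" "p ^ e dvd D * (D + N)"
  shows "p ^ e dvd unitprod p D N - unitprod p 0 N"
  using dvd_trans[OF assms(4) prod_add_cong[of "D * (D + N)" "\<lambda>j. j * (N - j)" "halfunits p N"]]
  by (simp add: unitprod_halfunits[OF assms(1-3)])

lemma pratio_core:
  assumes p: "prime p" and m: "0 \<le> m" and e: "p ^ e dvd unitprod p (p * Q) (p * m) - unitprod p 0 (p * m)"
  shows "pratio p e (ibinom (p * (Q + m)) (p * m)) (ibinom (Q + m) m)"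
proof (rule pratioI[OF unitprod_0_not_dvd[OF p] _ e])
  have "1 < p" using p by (rule prime_gt_1_int)
  with ibinom_core[of p "p * m" Q] m
  show "unitprod p 0 (p * m) * ibinom (p * (Q + m)) (p * m) =
    unitprod p (p * Q) (p * m) * ibinom (Q + m) m"
    by (simp add: algebra_simps)
qed

text \<open>The first two cases write the upper entry as \<open>Q + m\<close> with
  \<open>0 \<le> m\<close>, the shape that \<open>ibinom_core\<close> handles, and differ by
  symmetry; in the third the coefficient vanishes.\<close>

lemma ibinom_cases:
  fixes n k :: int
  assumes "\<And>m Q. 0 \<le> m \<Longrightarrow> P (Q + m) m" "\<And>m Q. 0 \<le> m \<Longrightarrow> P (Q + m) Q"
    "\<And>n k. k < 0 \<Longrightarrow> n < k \<Longrightarrow> P n k"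
  shows "P n k"
proof -
  consider "0 \<le> k" | "k < 0" "k \<le> n" | "k < 0" "n < k" by linarith
  then show ?thesis
  proof cases
    case 1 then show ?thesis using assms(1)[of k "n - k"] by simp
  next
    case 2 then show ?thesis using assms(2)[of "n - k" k] by simp
  qed (rule assms(3))
qed

text \<open>Here \<open>D = p * Q\<close> and \<open>D + N = p * (Q + m)\<close> are both divisible
  by \<open>p ^ s\<close>, so their product is by \<open>p ^ (2 * s)\<close>. For
  \<open>p = 2\<close> the bound \<open>2 \<le> s\<close> supplies the \<open>4 dvd N\<close> that
  pairing needs.\<close>

lemma pratio_ibinom_square:
  assumes p: "prime p" and s: "1 \<le> s" "odd p \<or> 2 \<le> s" and d: "p ^ s dvd p * n" "p ^ s dvd p * k"
  shows "pratio p (2 * s) (ibinom (p * n) (p * k)) (ibinom n k)"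
proof -
  have 4: "odd p \<or> 4 dvd x" if "p ^ s dvd x" for x
  proof (cases "odd p")
    case False
    then have "2 = p" using p by (intro primes_dvd_imp_eq) auto
    then have "p = 2" by simp
    moreover have "2 \<le> s" using s False by simp
    ultimately have "(2::int) ^ 2 dvd 2 ^ s" by (intro le_imp_power_dvd)
    then show ?thesis using that \<open>p = 2\<close> dvd_trans by fastforce
  qed simp
  have main: "pratio p (2 * s) (ibinom (p * (Q + m)) (p * m)) (ibinom (Q + m) m)"
    if "0 \<le> m" "p ^ s dvd p * m" "p ^ s dvd p * Q" for m Q
  proof (rule pratio_core[OF p that(1)], rule unitprod_cong_pair[OF p])
    show "odd p \<or> 4 dvd p * m" using that 4 by blast
    have "p ^ s dvd p * Q + p * m" using that by simp
    then show "p ^ (2 * s) dvd p * Q * (p * Q + p * m)"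
      using that unfolding mult_2 power_add by (intro mult_dvd_mono) auto
  qed simp
  show ?thesis using d
  proof (induction n k rule: ibinom_cases)
    case (1 m Q)
    then have "p ^ s dvd p * (Q + m) - p * m" by (intro dvd_diff)
    then show ?case using main[of m Q] 1 by (simp add: algebra_simps)
  next
    case (2 m Q)
    then have "p ^ s dvd p * (Q + m) - p * Q" by (intro dvd_diff)
    then have "pratio p (2 * s) (ibinom (p * (Q + m)) (p * m)) (ibinom (Q + m) m)"
      using main[of m Q] 2 by (simp add: algebra_simps)
    then show ?case
      using ibinom_sym[of "p * (Q + m)" "p * Q"] ibinom_sym[of "Q + m" Q] by (simp add: algebra_simps)
  next
    case (3 n k)
    then show ?case using prime_gt_1_int[OF p] by (simp add: ibinom_eq_0 mult_pos_neg pratio_refl)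
  qed
qed

text \<open>Absorption moves the factor \<open>p ^ t\<close> of \<open>n\<close> to the side of the
  lower entry, which uses up only \<open>p ^ s\<close> of it.\<close>

lemma ibinom_prime_power_dvd:
  fixes p :: int
  assumes "prime p" "p ^ t dvd n" "\<not> p dvd k" "s \<le> t"
  shows "p ^ (t - s) dvd ibinom n (p ^ s * k)"
proof -
  have p0: "p \<noteq> 0" using assms(1) by auto
  obtain c where c: "n = p ^ t * c" using assms(2) by blast
  have "p ^ s * (k * ibinom n (p ^ s * k)) = p ^ s * (p ^ (t - s) * (c * ibinom (n - 1) (p ^ s * k - 1)))"
    using ibinom_absorb[of "p ^ s * k" n] assms(4) unfolding c
    by (simp add: mult.assoc power_add[symmetric] flip: mult.assoc[of "p ^ s" "p ^ (t - s)"])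
  then have "k * ibinom n (p ^ s * k) = p ^ (t - s) * (c * ibinom (n - 1) (p ^ s * k - 1))"
    using p0 by simp
  then have "p ^ (t - s) dvd k * ibinom n (p ^ s * k)" by simp
  then show ?thesis using prime_power_dvd_cancel assms(1,3) by blast
qed

section \<open>Doubling both entries, modulo 4\<close>

lemma unitprod_2_double_step:
  assumes "0 \<le> m"
  shows "unitprod 2 D (2 * (m + 1)) = (D + 2 * m + 1) * unitprod 2 D (2 * m)"
proof -
  have "unitprod 2 D (2 * (m + 1)) = unitprod 2 D ((2 * m + 1) + 1)" by (simp add: algebra_simps)
  also have "\<dots> = unitprod 2 D (2 * m + 1)" using assms by (subst unitprod_step) auto
  also have "\<dots> = (D + 2 * m + 1) * unitprod 2 D (2 * m)"
    using assms by (subst unitprod_step) (auto simp: algebra_simps)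
  finally show ?thesis .
qed

text \<open>Shifting an odd number by \<open>2 * Q\<close> changes its sign modulo 4 exactly when
  \<open>Q\<close> is odd, and the product has \<open>m\<close> odd factors.\<close>

lemma unitprod_2_mod_4:
  assumes "0 \<le> m"
  shows "4 dvd unitprod 2 (2 * Q) (2 * m) - (if odd Q \<and> odd m then -1 else 1) * unitprod 2 0 (2 * m)"
  using assms
proof (induction m rule: int_ge_induct)
  case (step m)
  define X where "X = unitprod 2 (2 * Q) (2 * m)"
  define Y where "Y = unitprod 2 0 (2 * m)"
  define s :: int where "s = (if odd Q \<and> odd m then -1 else 1)"
  define s' :: int where "s' = (if odd Q \<and> odd (m + 1) then -1 else 1)"
  have IH: "4 dvd X - s * Y" using step.IH by (simp add: X_def Y_def s_def)
  have "4 dvd s * (2 * Q + 2 * m + 1) - s' * (2 * m + 1)"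
    unfolding s_def s'_def by (auto, presburger+)
  then have "4 dvd (2 * Q + 2 * m + 1) * (X - s * Y) + (s * (2 * Q + 2 * m + 1) - s' * (2 * m + 1)) * Y"
    using IH by (simp only: dvd_add dvd_mult dvd_mult2)
  also have "(2 * Q + 2 * m + 1) * (X - s * Y) + (s * (2 * Q + 2 * m + 1) - s' * (2 * m + 1)) * Y =
      (2 * Q + 2 * m + 1) * X - s' * ((2 * m + 1) * Y)"
    by (simp add: algebra_simps)
  finally show ?case
    using unitprod_2_double_step[OF step.hyps, of "2 * Q"] unitprod_2_double_step[OF step.hyps, of 0]
    by (simp only: X_def Y_def s'_def add_0)
qed simp

text \<open>With \<open>n = Q + m\<close> and \<open>k\<close> equal to \<open>m\<close> or
  \<open>Q\<close>, the entries \<open>Q\<close> and \<open>m\<close> are both odd exactly when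
  \<open>n\<close> is even and \<open>k\<close> is odd.\<close>

lemma ibinom_double_ratio:
  obtains X Y where "odd Y" "Y * ibinom (2 * n) (2 * k) = X * ibinom n k"
    "4 dvd X - (if even n \<and> odd k then -1 else 1) * Y"
proof -
  have main: "odd (unitprod 2 0 (2 * m)) \<and>
      unitprod 2 0 (2 * m) * ibinom (2 * (Q + m)) (2 * m) = unitprod 2 (2 * Q) (2 * m) * ibinom (Q + m) m"
    if "0 \<le> m" for m Q
    using ibinom_core[of 2 "2 * m" Q] unitprod_0_not_dvd[of 2 "2 * m"] that
    by (simp add: algebra_simps)
  have "\<exists>X Y. odd Y \<and> Y * ibinom (2 * n) (2 * k) = X * ibinom n k \<and>
    4 dvd X - (if even n \<and> odd k then -1 else 1) * Y"
  proof (induction n k rule: ibinom_cases)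
    case (1 m Q)
    show ?case
      by (rule exI[of _ "unitprod 2 (2 * Q) (2 * m)"], rule exI[of _ "unitprod 2 0 (2 * m)"])
        (use main[OF 1] unitprod_2_mod_4[OF 1, of Q] in auto)
  next
    case (2 m Q)
    have "ibinom (2 * (Q + m)) (2 * Q) = ibinom (2 * (Q + m)) (2 * m)" "ibinom (Q + m) Q = ibinom (Q + m) m"
      using ibinom_sym[of "2 * (Q + m)" "2 * Q"] ibinom_sym[of "Q + m" Q] by (simp_all add: algebra_simps)
    then show ?case
      by (intro exI[of _ "unitprod 2 (2 * Q) (2 * m)"] exI[of _ "unitprod 2 0 (2 * m)"])
        (use main[OF 2, of Q] unitprod_2_mod_4[OF 2, of Q] in auto)
  next
    case (3 n k)
    then show ?case
      by (intro exI[of _ "if even n \<and> odd k then -1 else 1"] exI[of _ 1]) (simp add: ibinom_eq_0)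
  qed
  then show thesis using that by blast
qed

text \<open>In the case of sign -1 the ratio is 1 only modulo 2, but there \<open>ibinom n k\<close>
  is even, which restores the modulus 4.\<close>

lemma ibinom_double_mod_4: "4 dvd ibinom (2 * n) (2 * k) - ibinom n k"
proof -
  obtain X Y where XY: "odd Y" "Y * ibinom (2 * n) (2 * k) = X * ibinom n k"
    "4 dvd X - (if even n \<and> odd k then -1 else 1) * Y"
    by (rule ibinom_double_ratio)
  have "4 dvd (X - Y) * ibinom n k"
  proof (cases "even n \<and> odd k")
    case True
    then have "2 ^ (1 - 0) dvd ibinom n (2 ^ 0 * k)"
      by (intro ibinom_prime_power_dvd) auto
    then obtain c where c: "ibinom n k = 2 * c" by auto
    have "even (X - Y)" using XY True by auto presburger
    then have "2 * 2 dvd (X - Y) * ibinom n k" unfolding c by (intro mult_dvd_mono) auto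
    then show ?thesis by simp
  next
    case False
    then show ?thesis using XY(3) by auto
  qed
  also have "(X - Y) * ibinom n k = Y * (ibinom (2 * n) (2 * k) - ibinom n k)"
    using XY(2) by (simp add: algebra_simps)
  finally have "2 ^ 2 dvd Y * (ibinom (2 * n) (2 * k) - ibinom n k)" by simp
  then have "2 ^ 2 dvd ibinom (2 * n) (2 * k) - ibinom n k"
    by (rule prime_power_dvd_cancel[rotated 2]) (use XY(1) in auto)
  then show ?thesis by simp
qed

text \<open>Keeps the sign -1 visible after the common power of 2 is removed, so that the signs of
  two blocks can be multiplied.\<close>

lemma ibinom_double_odd:
  assumes "odd k" "even n" "2 ^ t dvd n"
  obtains a b where "ibinom (2 * n) (2 * k) = 2 ^ t * a" "ibinom n k = 2 ^ t * b" "4 dvd a + b"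
proof -
  obtain X Y where XY: "odd Y" "Y * ibinom (2 * n) (2 * k) = X * ibinom n k"
    "4 dvd X - (if even n \<and> odd k then -1 else 1) * Y"
    by (rule ibinom_double_ratio)
  have "2 ^ (t - 0) dvd ibinom n (2 ^ 0 * k)"
    using assms by (intro ibinom_prime_power_dvd) auto
  then obtain b where b: "ibinom n k = 2 ^ t * b" by auto
  have "2 ^ t dvd Y * ibinom (2 * n) (2 * k)" unfolding XY(2) b by simp
  then have "2 ^ t dvd ibinom (2 * n) (2 * k)"
    by (rule prime_power_dvd_cancel[rotated 2]) (use XY(1) in auto)
  then obtain a where a: "ibinom (2 * n) (2 * k) = 2 ^ t * a" by auto
  have "2 ^ t * (Y * a) = 2 ^ t * (X * b)" using XY(2) unfolding a b by (simp add: algebra_simps)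
  then have "Y * a = X * b" by simp
  then have "Y * (a + b) = (X + Y) * b" by (simp add: algebra_simps)
  moreover have "4 dvd X + Y" using XY(3) assms by simp
  ultimately have "2 ^ 2 dvd Y * (a + b)" by simp
  then have "2 ^ 2 dvd a + b"
    by (rule prime_power_dvd_cancel[rotated 2]) (use XY(1) in auto)
  then show thesis using a b that by simp
qed

section \<open>Sums of inverse squares\<close>

text \<open>An integer representative of \<open>1/k\<^sup>2\<close> modulo \<open>p ^ r\<close> that is exactly multiplicative in \<open>k\<close>.\<close>

definition invsq :: "int \<Rightarrow> nat \<Rightarrow> int \<Rightarrow> int" where
  "invsq p r k = (if p dvd k then 0 else k ^ (2 * totient (nat (p ^ r)) - 2))"

text \<open>The square of Euler's congruence. The exponent is even, so it may be applied to the
  absolute value of \<open>k\<close>.\<close>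

lemma invsq_inverse:
  assumes "prime p" "\<not> p dvd k"
  shows "p ^ r dvd k ^ 2 * invsq p r k - 1"
proof -
  define f where "f = totient (nat (p ^ r))"
  have p1: "1 < p" using assms(1) by (rule prime_gt_1_int)
  then have f: "f > 0" by (simp add: f_def)
  have "coprime k (p ^ r)" using assms by (metis coprime_commute coprime_power_right_iff prime_imp_coprime)
  then have "coprime (int (nat \<bar>k\<bar>)) (int (nat (p ^ r)))" using p1 by simp
  then have "coprime (nat \<bar>k\<bar>) (nat (p ^ r))" by (simp only: coprime_int_iff)
  then have "[nat \<bar>k\<bar> ^ f = 1] (mod nat (p ^ r))" unfolding f_def by (rule euler_theorem)
  then have "[int (nat \<bar>k\<bar> ^ f) = int 1] (mod int (nat (p ^ r)))" by (simp only: cong_int_iff)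
  then have "[\<bar>k\<bar> ^ f = 1] (mod p ^ r)" using p1 by simp
  then have "[(\<bar>k\<bar> ^ f) ^ 2 = 1 ^ 2] (mod p ^ r)" by (rule cong_pow)
  moreover have "(\<bar>k\<bar> ^ f) ^ 2 = k ^ 2 * invsq p r k"
  proof -
    have "(\<bar>k\<bar> ^ f) ^ 2 = (\<bar>k\<bar> ^ 2) ^ f" by (simp only: power_mult[symmetric] mult.commute)
    also have "\<dots> = k ^ (2 * f)" by (simp add: power_mult)
    also have "2 * f = 2 + (2 * f - 2)" using f by simp
    finally show ?thesis using assms(2) by (simp only: invsq_def f_def power_add if_False)
  qed
  ultimately show ?thesis by (simp add: cong_iff_dvd_diff)
qed

text \<open>The modulus is independent of \<open>r\<close>: \<open>invsq p r\<close> is a fixed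
  power on the numbers prime to \<open>p\<close> and 0 elsewhere, and \<open>x\<close> and
  \<open>y\<close> fall into the same branch.\<close>

lemma invsq_cong:
  assumes "p ^ s dvd x - y" "1 \<le> s"
  shows "p ^ s dvd invsq p r x - invsq p r y"
proof -
  have "p dvd p ^ s" using assms(2) by simp
  then have "p dvd x - y" using assms(1) dvd_trans by blast
  then have "[x = y] (mod p)" by (simp add: cong_iff_dvd_diff)
  then have "p dvd x \<longleftrightarrow> p dvd y" by (rule cong_dvd_iff)
  moreover have "[x = y] (mod p ^ s)" using assms by (simp add: cong_iff_dvd_diff)
  ultimately show ?thesis
    by (auto simp: invsq_def cong_iff_dvd_diff[symmetric] intro: cong_pow)
qed

lemma invsq_minus [simp]: "invsq p r (- k) = invsq p r k"
proof -
  have "even (2 * totient (nat (p ^ r)) - 2)" by (cases "totient (nat (p ^ r))") auto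
  then show ?thesis by (simp add: invsq_def)
qed

lemma dvd_of_diff:
  fixes d x y :: int
  assumes "d dvd x - y" "d dvd y"
  shows "d dvd x"
  using dvd_add[OF assms] by simp

lemma sum_dvd_diff:
  fixes f g :: "'a \<Rightarrow> int"
  assumes "\<And>x. x \<in> A \<Longrightarrow> d dvd f x - g x"
  shows "d dvd sum f A - sum g A"
  unfolding sum_subtractf[symmetric] using assms by (rule dvd_sum)

lemma prime_ge_5_not_dvd:
  assumes "prime (p::int)" "5 \<le> p"
  shows "odd p" "\<not> p dvd 2" "\<not> p dvd 3" "\<not> p dvd 4"
proof -
  show "\<not> p dvd 2" "\<not> p dvd 3" "\<not> p dvd 4" using assms(2) by (auto dest!: zdvd_imp_le)
  show "odd p" using assms primes_dvd_imp_eq[of 2 p] by auto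
qed

text \<open>Multiplication by 2 permutes the residues, so the sum \<open>S\<close> satisfies
  \<open>S = S / 4\<close> modulo \<open>p ^ s\<close>, that is \<open>3 * S = 0\<close>, and 3 is
  invertible.\<close>

lemma sum_invsq_residues:
  assumes p: "prime p" "5 \<le> p" and s: "1 \<le> s" "s \<le> r"
  shows "p ^ s dvd (\<Sum>x\<in>{0..<p ^ s}. invsq p r x)"
proof -
  define q where "q = p ^ s"
  define S where "S = (\<Sum>x\<in>{0..<q}. invsq p r x)"
  define c where "c = invsq p r 2"
  have q0: "q > 0" using p by (simp add: q_def)
  have inj: "inj_on (\<lambda>x. 2 * x mod q) {0..<q}"
  proof
    fix x y assume xy: "x \<in> {0..<q}" "y \<in> {0..<q}" "2 * x mod q = 2 * y mod q"
    then have "q dvd 2 * x - 2 * y" by (simp add: mod_eq_dvd_iff)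
    then have "p ^ s dvd 2 * (x - y)" by (simp add: q_def algebra_simps)
    then have "q dvd x - y" unfolding q_def
      by (rule prime_power_dvd_cancel[rotated 2]) (simp_all add: p(1) prime_ge_5_not_dvd[OF p])
    then show "x = y" using xy(1,2) by (metis atLeastLessThan_iff mod_eq_dvd_iff mod_pos_pos_trivial)
  qed
  have "(\<lambda>x. 2 * x mod q) ` {0..<q} = {0..<q}"
    by (rule endo_inj_surj[OF _ _ inj]) (use q0 in auto)
  then have "S = (\<Sum>x\<in>(\<lambda>x. 2 * x mod q) ` {0..<q}. invsq p r x)" by (simp add: S_def)
  also have "\<dots> = (\<Sum>x\<in>{0..<q}. invsq p r (2 * x mod q))"
    using inj by (simp add: sum.reindex)
  finally have S: "S = (\<Sum>x\<in>{0..<q}. invsq p r (2 * x mod q))" .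
  have "q dvd S - (\<Sum>x\<in>{0..<q}. c * invsq p r x)"
    unfolding S
  proof (rule sum_dvd_diff)
    fix x
    have "c * invsq p r x = invsq p r (2 * x)"
      using p prime_ge_5_not_dvd[OF p] by (auto simp: c_def invsq_def power_mult_distrib prime_dvd_mult_iff)
    moreover have "q dvd (2 * x mod q) - 2 * x" by (simp add: mod_eq_dvd_iff[symmetric])
    ultimately show "q dvd invsq p r (2 * x mod q) - c * invsq p r x"
      unfolding q_def using s by (simp add: invsq_cong)
  qed
  then have 1: "q dvd S - c * S" by (simp add: S_def sum_distrib_left)
  have "p ^ r dvd 2 ^ 2 * c - 1" unfolding c_def
    using p prime_ge_5_not_dvd by (intro invsq_inverse) auto
  moreover have "q dvd p ^ r" unfolding q_def using s by (intro le_imp_power_dvd)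
  ultimately have 2: "q dvd 4 * c - 1" using dvd_trans by fastforce
  have "q dvd 4 * (S - c * S) + (4 * c - 1) * S" using 1 2 by (simp only: dvd_add dvd_mult dvd_mult2)
  also have "4 * (S - c * S) + (4 * c - 1) * S = 3 * S" by (simp add: algebra_simps)
  finally show ?thesis
    unfolding S_def q_def by (rule prime_power_dvd_cancel[rotated 2]) (simp_all add: p(1) prime_ge_5_not_dvd[OF p])
qed

lemma sum_invsq_block:
  assumes p: "prime p" "5 \<le> p" and s: "1 \<le> s" "s \<le> r"
  shows "p ^ s dvd (\<Sum>k\<in>{p ^ s * u<..p ^ s * (u + 1)}. invsq p r k)"
proof -
  define q where "q = p ^ s"
  have q0: "q > 0" using p by (simp add: q_def)
  have pq: "p dvd q" using s by (simp add: q_def)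
  have 1: "(\<Sum>k\<in>{q * u<..q * (u + 1)}. invsq p r k) = (\<Sum>i\<in>{0<..q}. invsq p r (q * u + i))"
    by (rule sum.reindex_bij_witness[of _ "\<lambda>i. q * u + i" "\<lambda>k. k - q * u"]) (auto simp: algebra_simps)
  have 2: "q dvd (\<Sum>i\<in>{0<..q}. invsq p r (q * u + i)) - (\<Sum>i\<in>{0<..q}. invsq p r i)"
    unfolding q_def using s by (intro sum_dvd_diff invsq_cong) auto
  have "(\<Sum>i\<in>{0<..q}. invsq p r i) = (\<Sum>i\<in>{0<..<q}. invsq p r i)"
    by (rule sum.mono_neutral_right) (use pq in \<open>auto simp: invsq_def\<close>)
  also have "\<dots> = (\<Sum>i\<in>{0..<q}. invsq p r i)"
    by (rule sum.mono_neutral_left) (auto simp: invsq_def)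
  finally have "q dvd (\<Sum>i\<in>{0<..q}. invsq p r i)"
    using sum_invsq_residues[OF assms] by (simp add: q_def)
  with 2 have "q dvd (\<Sum>i\<in>{0<..q}. invsq p r (q * u + i))" by (rule dvd_of_diff)
  then show ?thesis unfolding 1[symmetric] by (simp only: q_def)
qed

text \<open>Reflect the block by \<open>k\<close> to \<open>N - k\<close>, with \<open>N\<close> the
  sum of its end points. As \<open>N\<close> is odd the sign flips, as \<open>p ^ s\<close> divides
  \<open>N\<close> the inverse square stays; hence twice the sum is 0.\<close>

lemma sum_alt_invsq_block:
  assumes p: "prime p" "5 \<le> p" and s: "1 \<le> s"
  shows "p ^ s dvd (\<Sum>k\<in>{p ^ s * u<..p ^ s * (u + 1)}. (if even k then 1 else -1) * invsq p r k)"
proof -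
  define q where "q = p ^ s"
  define e :: "int \<Rightarrow> int" where "e = (\<lambda>k. if even k then 1 else -1)"
  define N where "N = q * (2 * u + 1)"
  have q0: "q > 0" using p by (simp add: q_def)
  have pq: "p dvd q" using s by (simp add: q_def)
  have oddN: "odd N" using prime_ge_5_not_dvd[OF p] by (simp add: N_def q_def)
  define S where "S = (\<Sum>k\<in>{q * u<..<q * (u + 1)}. e k * invsq p r k)"
  have 1: "(\<Sum>k\<in>{q * u<..q * (u + 1)}. e k * invsq p r k) = S"
    unfolding S_def by (rule sum.mono_neutral_right) (use pq in \<open>auto simp: invsq_def\<close>)
  have "S = (\<Sum>k\<in>{q * u<..<q * (u + 1)}. e (N - k) * invsq p r (N - k))"
    unfolding S_def by (rule sum.reindex_bij_witness[of _ "\<lambda>k. N - k" "\<lambda>k. N - k"]) (auto simp: N_def algebra_simps)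
  also have "\<dots> = (\<Sum>k\<in>{q * u<..<q * (u + 1)}. - (e k * invsq p r (N - k)))"
    using oddN by (intro sum.cong) (auto simp: e_def)
  finally have S: "S = (\<Sum>k\<in>{q * u<..<q * (u + 1)}. - (e k * invsq p r (N - k)))" .
  have "q dvd (\<Sum>k\<in>{q * u<..<q * (u + 1)}. - (e k * invsq p r (N - k))) -
      (\<Sum>k\<in>{q * u<..<q * (u + 1)}. - (e k * invsq p r k))"
  proof (rule sum_dvd_diff)
    fix k
    have "p ^ s dvd invsq p r (N - k) - invsq p r (- k)"
      using s by (intro invsq_cong) (auto simp: N_def q_def)
    then have "q dvd - e k * (invsq p r (N - k) - invsq p r k)" unfolding q_def by (intro dvd_mult) simp
    then show "q dvd - (e k * invsq p r (N - k)) - - (e k * invsq p r k)" by (simp add: algebra_simps)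
  qed
  then have "q dvd S - - S" using S by (simp add: S_def sum_negf)
  then have "p ^ s dvd 2 * S" by (simp add: q_def)
  then have "p ^ s dvd S"
    by (rule prime_power_dvd_cancel[rotated 2]) (simp_all add: p(1) prime_ge_5_not_dvd[OF p])
  then show ?thesis using 1 by (simp add: e_def q_def)
qed

lemma sum_invsq_multiple:
  assumes p: "prime p" "5 \<le> p" and s: "1 \<le> s" "p ^ s dvd N" "0 \<le> N"
  shows "p ^ s dvd (\<Sum>k\<in>{0<..N}. invsq p s k)"
proof -
  obtain v where v: "N = p ^ s * v" using s by blast
  have q0: "p ^ s > 0" using p by simp
  then have "0 \<le> v" using s(3) v by (simp add: zero_le_mult_iff)
  then have "p ^ s dvd (\<Sum>k\<in>{0<..p ^ s * v}. invsq p s k)"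
  proof (induction v rule: int_ge_induct)
    case (step v)
    have "{0<..p ^ s * (v + 1)} = {0<..p ^ s * v} \<union> {p ^ s * v<..p ^ s * (v + 1)}"
      using q0 step.hyps by (intro ivl_disj_un_two(6)[symmetric]) auto
    then have "(\<Sum>k\<in>{0<..p ^ s * (v + 1)}. invsq p s k) =
        (\<Sum>k\<in>{0<..p ^ s * v}. invsq p s k) + (\<Sum>k\<in>{p ^ s * v<..p ^ s * (v + 1)}. invsq p s k)"
      by (simp add: sum.union_disjoint)
    then show ?case using step.IH sum_invsq_block[OF p s(1) order_refl, of v] by simp
  qed simp
  then show ?thesis by (simp add: v)
qed

text \<open>Modulo \<open>p ^ s\<close> the numbers \<open>j\<close> and \<open>N - j\<close> have
  the same inverse square, so the full sum is twice this one.\<close>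

lemma sum_halfunits_invsq:
  assumes p: "prime p" "5 \<le> p" and s: "1 \<le> s" "p ^ s dvd N" "0 \<le> N"
  shows "p ^ s dvd (\<Sum>j\<in>halfunits p N. invsq p s j)"
proof -
  have "p dvd p ^ s" using s by simp
  then have pN: "p dvd N" using s dvd_trans by blast
  have "(\<Sum>k\<in>{0<..N}. invsq p s k) = (\<Sum>k | k \<in> {1..N} \<and> \<not> p dvd k. invsq p s k)"
    by (rule sum.mono_neutral_right) (auto simp: invsq_def)
  also have "\<dots> = (\<Sum>j\<in>halfunits p N. invsq p s j) + (\<Sum>j\<in>(\<lambda>j. N - j) ` halfunits p N. invsq p s j)"
    unfolding units_eq_halfunits[OF p(1) pN disjI1[OF prime_ge_5_not_dvd(1)[OF p]]]
    by (rule sum.union_disjoint) (simp, simp, auto simp: halfunits_def)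
  also have "(\<Sum>j\<in>(\<lambda>j. N - j) ` halfunits p N. invsq p s j) = (\<Sum>j\<in>halfunits p N. invsq p s (N - j))"
    by (subst sum.reindex) (auto simp: inj_on_def)
  finally have "p ^ s dvd (\<Sum>j\<in>halfunits p N. invsq p s j) + (\<Sum>j\<in>halfunits p N. invsq p s (N - j))"
    using sum_invsq_multiple[OF assms] by simp
  moreover have "p ^ s dvd (\<Sum>j\<in>halfunits p N. invsq p s (N - j)) - (\<Sum>j\<in>halfunits p N. invsq p s j)"
  proof (rule sum_dvd_diff)
    fix j
    have "p ^ s dvd invsq p s (N - j) - invsq p s (- j)" using s by (intro invsq_cong) auto
    then show "p ^ s dvd invsq p s (N - j) - invsq p s j" by simp
  qed
  ultimately have "p ^ s dvd ((\<Sum>j\<in>halfunits p N. invsq p s j) + (\<Sum>j\<in>halfunits p N. invsq p s (N - j)))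
      - ((\<Sum>j\<in>halfunits p N. invsq p s (N - j)) - (\<Sum>j\<in>halfunits p N. invsq p s j))"
    by (rule dvd_diff)
  then have "p ^ s dvd 2 * (\<Sum>j\<in>halfunits p N. invsq p s j)" by simp
  then show ?thesis
    by (rule prime_power_dvd_cancel[rotated 2]) (simp_all add: p(1) prime_ge_5_not_dvd[OF p])
qed

section \<open>Ratios modulo cubes\<close>

text \<open>Expand the paired product in \<open>E = D * (D + N)\<close>. The terms from
  \<open>E ^ 2\<close> on vanish to the required order, and the linear coefficient \<open>S\<close>
  contributes another \<open>p ^ s\<close>.\<close>

lemma unitprod_cong_cube:
  assumes p: "prime p" "5 \<le> p" and s: "1 \<le> s" "s \<le> r" "p ^ s dvd N" "0 \<le> N"
    and D: "p ^ (r + s) dvd D * (D + N)"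
  shows "p ^ (r + 2 * s) dvd unitprod p D N - unitprod p 0 N"
proof -
  define J where "J = halfunits p N"
  define a where "a = (\<lambda>j. j * (N - j))"
  define Y where "Y = (\<Prod>j\<in>J. a j)"
  define S where "S = (\<Sum>j\<in>J. \<Prod>i\<in>J - {j}. a i)"
  define E where "E = D * (D + N)"
  have fin: "finite J" by (simp add: J_def)
  have "p dvd p ^ s" using s by simp
  then have pN: "p dvd N" using s dvd_trans by blast
  note half = unitprod_halfunits[OF p(1) pN disjI1[OF prime_ge_5_not_dvd(1)[OF p]]]
  \<comment> \<open>Modulo \<open>p ^ s\<close> the factor \<open>j * (N - j)\<close> is
    \<open>- j ^ 2\<close>, so leaving it out of \<open>Y\<close> amounts to multiplying
    \<open>Y\<close> by \<open>- invsq p s j\<close>.\<close>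
  have "p ^ s dvd S - (\<Sum>j\<in>J. - (invsq p s j * Y))"
    unfolding S_def
  proof (rule sum_dvd_diff)
    fix j assume j: "j \<in> J"
    define Z where "Z = (\<Prod>i\<in>J - {j}. a i)"
    have Y: "Y = a j * Z" unfolding Y_def Z_def using fin j by (rule prod.remove)
    have "\<not> p dvd j" using j by (simp add: J_def halfunits_def)
    then have 1: "p ^ s dvd j ^ 2 * invsq p s j - 1" using p by (intro invsq_inverse)
    have "p ^ s dvd N * (invsq p s j * j * Z) - (j ^ 2 * invsq p s j - 1) * Z"
      using 1 s(3) by (simp only: dvd_diff dvd_mult2)
    also have "\<dots> = Z - - (invsq p s j * Y)"
      by (simp add: Y a_def algebra_simps power2_eq_square)
    finally show "p ^ s dvd (\<Prod>i\<in>J - {j}. a i) - - (invsq p s j * Y)" by (simp add: Z_def)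
  qed
  moreover have "p ^ s dvd (\<Sum>j\<in>J. - (invsq p s j * Y))"
    using sum_halfunits_invsq[OF p s(1,3,4)]
    by (simp add: sum_negf flip: sum_distrib_right J_def)
  ultimately have S: "p ^ s dvd S" using dvd_of_diff by blast
  have "p ^ (r + 2 * s) dvd p ^ ((r + s) * 2)" using s by (intro le_imp_power_dvd) simp
  also have "\<dots> dvd E ^ 2" unfolding power_mult E_def using D by (rule dvd_power_same)
  also have "\<dots> dvd (\<Prod>j\<in>J. a j + E) - (\<Prod>j\<in>J. a j) - E * S"
    unfolding S_def using fin by (rule prod_add_cong2)
  finally have "p ^ (r + 2 * s) dvd (\<Prod>j\<in>J. a j + E) - (\<Prod>j\<in>J. a j) - E * S" .
  moreover have "p ^ (r + s) * p ^ s dvd E * S" using D S unfolding E_def by (intro mult_dvd_mono)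
  then have "p ^ (r + 2 * s) dvd E * S" by (simp add: mult_2 flip: power_add add.assoc)
  ultimately have "p ^ (r + 2 * s) dvd (\<Prod>j\<in>J. a j + E) - (\<Prod>j\<in>J. a j)" using dvd_of_diff by blast
  then show ?thesis by (simp add: half J_def a_def E_def)
qed

text \<open>Symmetry, negation of the upper entry and absorption combined. The pair
  \<open>(n, k)\<close> becomes \<open>(- k, - n)\<close>, which keeps the difference
  \<open>n - k\<close> and makes negative entries positive.\<close>

lemma ibinom_reflect:
  assumes "k \<le> n"
  shows "k * ibinom n k = (-1) ^ nat (n - k) * n * ibinom (- k) (- n)"
proof -
  have "ibinom n k = (-1) ^ nat (n - k) * ibinom (- k - 1) (n - k)"
    using ibinom_negate_upper[of "n - k" n] assms ibinom_sym[of n k] by (simp add: algebra_simps)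
  moreover have "n * ibinom (- k) (n - k) = k * ibinom (- k - 1) (n - k)"
    using ibinom_absorb_comp[of "- k" "n - k"] by (simp add: algebra_simps)
  moreover have "ibinom (- k) (- n) = ibinom (- k) (n - k)"
    using ibinom_sym[of "- k" "- n"] by (simp add: algebra_simps)
  ultimately show ?thesis by (simp add: algebra_simps)
qed

text \<open>The pairing needs \<open>p ^ (r + s) dvd D * (D + N)\<close>. For
  \<open>0 \<le> k\<close> these factors are \<open>p * (n - k)\<close> and \<open>p * n\<close>;
  for \<open>k < 0\<close> symmetry gives \<open>p * k\<close> and \<open>p * n\<close>, which
  serves only if \<open>p ^ r\<close> divides \<open>p * n\<close>. Otherwise the coefficients
  vanish (\<open>0 \<le> n\<close>) or are reflected (\<open>n < 0\<close>).\<close>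

lemma pratio_ibinom_cube:
  assumes p: "prime p" "5 \<le> p" and s: "1 \<le> s" "s \<le> r"
    and d: "p ^ s dvd p * n" "p ^ s dvd p * k" and r: "p ^ r dvd p * n \<or> p ^ r dvd p * (n - k)"
  shows "pratio p (r + 2 * s) (ibinom (p * n) (p * k)) (ibinom n k)"
proof -
  have p0: "p > 0" using p by simp
  have main: "pratio p (r + 2 * s) (ibinom (p * (Q + m)) (p * m)) (ibinom (Q + m) m)"
    if "0 \<le> m" "p ^ s dvd p * m" "p ^ (r + s) dvd p * Q * (p * Q + p * m)" for m Q
    using that p0 by (intro pratio_core p unitprod_cong_cube s) auto
  have dnk: "p ^ s dvd p * (n - k)" using d by (simp add: right_diff_distrib)
  consider "0 \<le> k" | "k < 0" "k \<le> n" "p ^ r dvd p * n" | "k < 0" "k \<le> n" "0 \<le> n"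
    | "k < 0" "k \<le> n" "p ^ r dvd p * (n - k)" "n < 0" | "k < 0" "n < k"
    using r by linarith
  then show ?thesis
  proof cases
    case 1
    have "p ^ (r + s) dvd p * (n - k) * (p * n)"
      using r
    proof
      assume "p ^ r dvd p * n"
      then have "p ^ s * p ^ r dvd p * (n - k) * (p * n)" using dnk by (rule mult_dvd_mono[rotated])
      then show ?thesis by (simp add: power_add mult.commute)
    next
      assume "p ^ r dvd p * (n - k)"
      then have "p ^ r * p ^ s dvd p * (n - k) * (p * n)" using d(1) by (rule mult_dvd_mono)
      then show ?thesis by (simp add: power_add)
    qed
    then show ?thesis using main[of k "n - k"] 1 d by (simp add: algebra_simps)
  next
    case 2
    have "p ^ s * p ^ r dvd p * k * (p * n)" using d(2) 2(3) by (rule mult_dvd_mono)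
    then have "pratio p (r + 2 * s) (ibinom (p * n) (p * (n - k))) (ibinom n (n - k))"
      using main[of "n - k" k] 2 dnk by (simp add: algebra_simps power_add)
    then show ?thesis
      using ibinom_sym[of n k] ibinom_sym[of "p * n" "p * k"] by (simp add: algebra_simps)
  next
    case 3
    have "p * n < p * (n - k)" using p0 3 by simp
    then have "ibinom (p * n) (p * (n - k)) = 0" "ibinom n (n - k) = 0"
      using 3 p0 by (auto intro!: ibinom_eq_0')
    then have "ibinom (p * n) (p * k) = 0" "ibinom n k = 0"
      using ibinom_sym[of n k] ibinom_sym[of "p * n" "p * k"] by (simp_all add: algebra_simps)
    then show ?thesis using p by (simp add: pratio_refl)
  next
    case 4
    \<comment> \<open>After reflection \<open>D = p * (n - k)\<close> carries \<open>p ^ r\<close>,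
      and \<open>D + N = - (p * k)\<close> carries \<open>p ^ s\<close>.\<close>
    have "p ^ s dvd - (p * k)" using d(2) by simp
    then have "p ^ r * p ^ s dvd p * (n - k) * - (p * k)" using 4(3) by (intro mult_dvd_mono)
    then have "p ^ (r + s) dvd p * (n - k) * (p * (n - k) + p * (- n))"
      by (simp add: algebra_simps power_add)
    then have "pratio p (r + 2 * s) (ibinom (p * (- k)) (p * (- n))) (ibinom (- k) (- n))"
      using main[of "- n" "n - k"] 4 d by simp
    then obtain X Y where XY: "\<not> p dvd Y"
      "Y * ibinom (- (p * k)) (- (p * n)) = X * ibinom (- k) (- n)" "p ^ (r + 2 * s) dvd X - Y"
      unfolding pratio_def by auto
    define e :: int where "e = (-1) ^ nat (n - k)"
    have "even (nat (p * n - p * k)) \<longleftrightarrow> even (nat (n - k))"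
      using 4 p0 prime_ge_5_not_dvd(1)[OF p] by (simp add: even_nat_iff flip: right_diff_distrib)
    then have e': "(-1) ^ nat (p * n - p * k) = e" unfolding e_def by (auto simp: minus_one_power_iff)
    have "p * (k * ibinom (p * n) (p * k)) = p * (e * n * ibinom (- (p * k)) (- (p * n)))"
      using ibinom_reflect[of "p * k" "p * n"] 4 p0 e' by (simp add: algebra_simps)
    then have 1: "k * ibinom (p * n) (p * k) = e * n * ibinom (- (p * k)) (- (p * n))"
      using p0 by simp
    have 2: "k * ibinom n k = e * n * ibinom (- k) (- n)"
      using ibinom_reflect[of k n] 4 by (simp add: e_def)
    \<comment> \<open>The reflection has the same sign and the same quotient of \<open>n\<close> by
      \<open>k\<close> on both levels, so it does not disturb the ratio.\<close>
    have "k * (Y * ibinom (p * n) (p * k)) = e * n * (Y * ibinom (- (p * k)) (- (p * n)))"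
      using 1 by (simp add: algebra_simps)
    also have "\<dots> = k * (X * ibinom n k)"
      using 2 unfolding XY(2) by (simp add: algebra_simps)
    finally have "Y * ibinom (p * n) (p * k) = X * ibinom n k" using 4 by simp
    with XY show ?thesis by (intro pratioI)
  next
    case 5
    then have "ibinom (p * n) (p * k) = 0" "ibinom n k = 0"
      using p0 by (auto intro!: ibinom_eq_0 mult_pos_neg)
    then show ?thesis using p(2) by (simp add: pratio_refl)
  qed
qed

section \<open>Blockwise congruences and summation\<close>

text \<open>Here \<open>m\<close> is arbitrary and no pairing is used: each factor
  \<open>p * Q + j\<close> is \<open>j\<close> modulo \<open>p ^ r\<close>.\<close>

lemma ibinom_core_cong:
  fixes p :: int
  assumes p: "prime p" and m: "0 \<le> m" and d: "p ^ r dvd p * Q"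
  shows "p ^ r dvd ibinom (p * Q + m) m - ibinom (Q + m div p) (m div p)"
proof -
  have "[unitprod p (p * Q) m = unitprod p 0 m] (mod p ^ r)"
    unfolding unitprod_def using d by (intro cong_prod) (simp add: cong_iff_dvd_diff)
  then have "p ^ r dvd unitprod p (p * Q) m - unitprod p 0 m" by (simp add: cong_iff_dvd_diff)
  with unitprod_0_not_dvd[OF p] ibinom_core[OF prime_gt_1_int[OF p] m]
  have "pratio p r (ibinom (p * Q + m) m) (ibinom (Q + m div p) (m div p))"
    by (rule pratioI)
  from pratio_dvd_diff[OF p this, of 0] show ?thesis by simp
qed

text \<open>Negating both upper entries brings the coefficients into the form of
  \<open>ibinom_core_cong\<close> with \<open>Q = - A\<close>; the signs are those of
  \<open>k\<close> and \<open>k div p\<close>. For \<open>k < 0\<close> use \<open>k\<close> to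
  \<open>p * A - 1 - k\<close>, whose quotient by \<open>p\<close> is
  \<open>A - 1 - k div p\<close>.\<close>

lemma ibinom_pred_cong:
  fixes p :: int
  assumes p: "prime p" "odd p" and d: "p ^ r dvd p * A"
  shows "p ^ r dvd ibinom (p * A - 1) k -
    (if even (k + k div p) then 1 else -1) * ibinom (A - 1) (k div p)"
proof -
  have p1: "1 < p" using p(1) by (rule prime_gt_1_int)
  have main: "p ^ r dvd ibinom (p * A - 1) k -
      (if even (k + k div p) then 1 else -1) * ibinom (A - 1) (k div p)" if k: "0 \<le> k" for k
  proof -
    define u where "u = k div p"
    define a :: int where "a = (-1) ^ nat k"
    define b :: int where "b = (-1) ^ nat u"
    have u: "0 \<le> u" using k p1 by (simp add: u_def pos_imp_zdiv_nonneg_iff)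
    have bb: "b * b = 1" by (simp add: b_def flip: power_add)
    have ab: "a * b = (if even (k + u) then 1 else -1)"
      using k u by (auto simp: a_def b_def minus_one_power_iff even_nat_iff)
    have "p ^ r dvd ibinom (p * (- A) + k) k - ibinom (- A + k div p) (k div p)"
      using d by (intro ibinom_core_cong p k) simp
    then have "p ^ r dvd a * (ibinom (k - p * A) k - ibinom (u - A) u)"
      by (simp add: u_def)
    also have "a * (ibinom (k - p * A) k - ibinom (u - A) u) =
        a * ibinom (k - p * A) k - a * b * (b * ibinom (u - A) u)"
      using bb by (simp add: algebra_simps)
    also have "a * ibinom (k - p * A) k = ibinom (p * A - 1) k"
      using ibinom_negate_upper[OF k, of "p * A - 1"] by (simp add: a_def)
    also have "b * ibinom (u - A) u = ibinom (A - 1) u"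
      using ibinom_negate_upper[OF u, of "A - 1"] by (simp add: b_def)
    finally show ?thesis unfolding ab by (simp only: u_def)
  qed
  have km: "k = p * (k div p) + k mod p" "0 \<le> k mod p" "k mod p < p" using p1 by auto
  consider "0 \<le> k" | "k < 0" "k \<le> p * A - 1" | "k < 0" "p * A \<le> k" by linarith
  then show ?thesis
  proof cases
    case 1
    then show ?thesis by (rule main)
  next
    case 2
    define u where "u = k div p"
    define k' where "k' = p * A - 1 - k"
    have "k' = p * (A - 1 - u) + (p - 1 - k mod p)"
      using km(1) by (simp add: k'_def u_def algebra_simps)
    then have k': "k' div p = A - 1 - u"
      using km(2,3) by (intro int_div_pos_eq[of _ _ _ "p - 1 - k mod p"]) auto
    have "even (k' + (A - 1 - u)) \<longleftrightarrow> even (k + u)"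
      using p(2) by (auto simp: k'_def)
    moreover have "0 \<le> k'" using 2 by (simp add: k'_def)
    moreover have "ibinom (p * A - 1) k' = ibinom (p * A - 1) k" unfolding k'_def by (rule ibinom_sym)
    moreover have "ibinom (A - 1) (A - 1 - u) = ibinom (A - 1) u" by (rule ibinom_sym)
    ultimately show ?thesis using main[of k'] by (simp add: k' u_def[symmetric])
  next
    case 3
    then have "p * A div p \<le> k div p" using p1 by (intro zdiv_mono1) auto
    then have "A \<le> k div p" using p1 by simp
    moreover have "k div p < 0" using 3 p1 by (intro div_neg_pos_less0) auto
    ultimately show ?thesis using 3 by (simp add: ibinom_eq_0)
  qed
qed

text \<open>For \<open>B \<le> N\<close> pass to the complementary lower entry
  \<open>p * (N - B) + t\<close>, whose last digit the core congruence discards. For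
  \<open>N < 0 \<le> B\<close> negation of the upper entry turns the digit \<open>t\<close> into
  \<open>p - 1 - t\<close>.\<close>

lemma ibinom_floor_cong:
  fixes p :: int
  assumes p: "prime p" "odd p" and d: "p ^ r dvd p * B" and t: "0 \<le> t" "t < p"
  shows "p ^ r dvd ibinom (p * N + t) (p * B) - ibinom N B"
proof -
  have p1: "1 < p" using p(1) by (rule prime_gt_1_int)
  have main: "p ^ r dvd ibinom (p * N + t) (p * B) - ibinom N B"
    if "B \<le> N" "0 \<le> t" "t < p" for N t
  proof -
    define m where "m = p * (N - B) + t"
    have m: "0 \<le> m" "m div p = N - B" using that p1 by (auto simp: m_def intro: int_div_pos_eq)
    have "p ^ r dvd ibinom (p * B + m) m - ibinom (B + m div p) (m div p)"
      by (intro ibinom_core_cong p m d)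
    moreover have "p * B + m = p * N + t" by (simp add: m_def algebra_simps)
    moreover have "m = p * N + t - p * B" by (simp add: m_def algebra_simps)
    ultimately show ?thesis using ibinom_sym[of "p * N + t" "p * B"] ibinom_sym[of N B] m(2) by simp
  qed
  have lt: "p * N + t < p * B" if "N < B"
  proof -
    have "p * (N + 1) \<le> p * B" using that p1 by (intro mult_left_mono) auto
    then show ?thesis using t by (simp add: algebra_simps)
  qed
  consider "B \<le> N" | "N < B" "0 \<le> B" "0 \<le> N" | "N < B" "0 \<le> B" "N < 0" | "N < B" "B < 0" by linarith
  then show ?thesis
  proof cases
    case 1
    then show ?thesis using t by (rule main)
  next
    case 2
    then have "0 \<le> p * N + t" using p1 t by simp
    then show ?thesis using 2 lt by (simp add: ibinom_eq_0')
  next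
    case 3
    have pB: "0 \<le> p * B" using 3 p1 by simp
    define e :: int where "e = (-1) ^ nat B"
    have e: "(-1) ^ nat (p * B) = e"
      using 3 pB p(2) by (auto simp: e_def minus_one_power_iff even_nat_iff)
    have "p ^ r dvd ibinom (p * (B - N - 1) + (p - 1 - t)) (p * B) - ibinom (B - N - 1) B"
      using 3 t by (intro main) auto
    then have "p ^ r dvd e * (ibinom (p * (B - N - 1) + (p - 1 - t)) (p * B) - ibinom (B - N - 1) B)"
      by (rule dvd_mult)
    also have "\<dots> = ibinom (p * N + t) (p * B) - ibinom N B"
      using ibinom_negate_upper[OF pB, of "p * N + t"] ibinom_negate_upper[OF 3(2), of N] e
      by (simp add: algebra_simps e_def)
    finally show ?thesis .
  next
    case 4
    then have "p * B < 0" using p1 by (simp add: mult_pos_neg)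
    then show ?thesis using 4 lt by (simp add: ibinom_eq_0)
  qed
qed

section \<open>Summation over nested blocks\<close>

lemma sum_blocks:
  fixes W g :: "int \<Rightarrow> int"
  assumes q: "0 < q" and ab: "a \<le> b"
  shows "(\<Sum>K\<in>{q * a..<q * b}. W K * g (K div q)) =
         (\<Sum>u\<in>{a..<b}. g u * (\<Sum>K\<in>{q * u..<q * (u + 1)}. W K))"
  using ab
proof (induction b rule: int_ge_induct)
  case (step b)
  have le: "q * a \<le> q * b" "q * b \<le> q * (b + 1)" using q step.hyps by auto
  have "(\<Sum>K\<in>{q * b..<q * (b + 1)}. W K * g (K div q)) = (\<Sum>K\<in>{q * b..<q * (b + 1)}. g b * W K)"
  proof (rule sum.cong[OF refl])
    fix K assume "K \<in> {q * b..<q * (b + 1)}"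
    then have "K div q = b"
      by (intro int_div_pos_eq[of K q b "K - q * b"]) (auto simp: algebra_simps)
    then show "W K * g (K div q) = g b * W K" by simp
  qed
  moreover have "(\<Sum>K\<in>{q * a..<q * (b + 1)}. W K * g (K div q)) =
      (\<Sum>K\<in>{q * a..<q * b}. W K * g (K div q)) + (\<Sum>K\<in>{q * b..<q * (b + 1)}. W K * g (K div q))"
    unfolding ivl_disj_un_two(3)[OF le, symmetric] by (rule sum.union_disjoint) auto
  moreover have "{a..<b + 1} = insert b {a..<b}" using step.hyps by auto
  ultimately show ?case using step.IH by (simp add: sum_distrib_left add.commute)
qed simp

text \<open>Replace \<open>G r K\<close> successively by \<open>G (r - s) (K div p ^ s)\<close>
  until the index is 0. Each replacement error is constant on blocks of length
  \<open>p ^ s\<close>.\<close>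

lemma weighted_sum_dvd:
  fixes p :: int and W :: "int \<Rightarrow> int" and G :: "nat \<Rightarrow> int \<Rightarrow> int"
  assumes p: "0 < p" and ab: "a \<le> b"
    and G: "\<And>i K. i < r \<Longrightarrow> p ^ Suc i dvd G (Suc i) K - G i (K div p)"
    and W: "\<And>s u. s \<le> r \<Longrightarrow> p ^ s dvd (\<Sum>K\<in>{p ^ s * u..<p ^ s * (u + 1)}. W K)"
  shows "p ^ r dvd (\<Sum>K\<in>{p ^ r * a..<p ^ r * b}. W K * G r K)"
proof -
  define I where "I = {p ^ r * a..<p ^ r * b}"
  have split: "(\<Sum>K\<in>I. W K * g (K div p ^ s)) =
      (\<Sum>u\<in>{p ^ (r - s) * a..<p ^ (r - s) * b}. g u * (\<Sum>K\<in>{p ^ s * u..<p ^ s * (u + 1)}. W K))"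
    if "s \<le> r" for g s
  proof -
    have "p ^ r = p ^ s * p ^ (r - s)" using that by (simp flip: power_add)
    then show ?thesis using p ab sum_blocks[of "p ^ s" "p ^ (r - s) * a" "p ^ (r - s) * b" W g]
      by (simp add: I_def mult.assoc)
  qed
  have "p ^ r dvd (\<Sum>K\<in>I. W K * G r K) - (\<Sum>K\<in>I. W K * G (r - s) (K div p ^ s))" if "s \<le> r" for s
    using that
  proof (induction s)
    case (Suc s)
    define h where "h = (\<lambda>u. G (r - s) u - G (r - Suc s) (u div p))"
    have rs: "r - s = Suc (r - Suc s)" using Suc.prems by simp
    have h: "p ^ (r - s) dvd h u" for u
      unfolding h_def using G[of "r - Suc s" u] rs Suc.prems by simp
    \<comment> \<open>The error supplies \<open>p ^ (r - s)\<close> and the weights of a block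
      supply \<open>p ^ s\<close>.\<close>
    have "p ^ r dvd (\<Sum>K\<in>I. W K * h (K div p ^ s))"
      unfolding split[OF Suc_leD[OF Suc.prems]]
    proof (rule dvd_sum)
      fix u
      have "p ^ (r - s) * p ^ s dvd h u * (\<Sum>K\<in>{p ^ s * u..<p ^ s * (u + 1)}. W K)"
        using h Suc.prems by (intro mult_dvd_mono W) auto
      then show "p ^ r dvd h u * (\<Sum>K\<in>{p ^ s * u..<p ^ s * (u + 1)}. W K)"
        using Suc.prems by (simp flip: power_add)
    qed
    also have "(\<Sum>K\<in>I. W K * h (K div p ^ s)) =
        (\<Sum>K\<in>I. W K * G (r - s) (K div p ^ s)) - (\<Sum>K\<in>I. W K * G (r - Suc s) (K div p ^ Suc s))"
      using p by (simp add: h_def right_diff_distrib sum_subtractf zdiv_zmult2_eq[symmetric] mult.commute)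
    finally have "p ^ r dvd ((\<Sum>K\<in>I. W K * G r K) - (\<Sum>K\<in>I. W K * G (r - s) (K div p ^ s))) + \<dots>"
      using Suc by (intro dvd_add) auto
    then show ?case by simp
  qed simp
  from this[of r] have "p ^ r dvd (\<Sum>K\<in>I. W K * G r K) - (\<Sum>K\<in>I. W K * G 0 (K div p ^ r))" by simp
  moreover have "p ^ r dvd (\<Sum>K\<in>I. W K * G 0 (K div p ^ r))"
    unfolding split[OF order_refl] by (intro dvd_sum dvd_mult W) simp
  ultimately show ?thesis unfolding I_def by (rule dvd_of_diff)
qed

section \<open>The summands as integers\<close>

text \<open>Factor \<open>i\<close> of block \<open>j\<close>, counted from 0, so
  \<open>int i * k\<close> is the multiple of \<open>k\<close> subtracted in the upper
  entry.\<close>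

definition A_fac :: "nat list \<Rightarrow> (nat \<Rightarrow> int) \<Rightarrow> int \<Rightarrow> nat \<Rightarrow> nat \<Rightarrow> int" where
  "A_fac lam n k j i = ibinom ((\<Sum>t\<le>i. n (blockstart lam j + t)) - int i * k) (n (blockstart lam j + i) - k)"

definition A_int :: "nat list \<Rightarrow> (nat \<Rightarrow> int) \<Rightarrow> int \<Rightarrow> int" where
  "A_int lam n k = (\<Prod>j<length lam. \<Prod>i<lam ! j. A_fac lam n k j i)"

lemma gmultinom_map_upt:
  "gmultinom (map f [0..<l]) k = of_int (\<Prod>i<l. ibinom ((\<Sum>t\<le>i. f t) - int i * k) (f i - k))"
proof -
  have "sum_list (take (Suc i) (map f [0..<l])) = (\<Sum>t\<le>i. f t)" if "i < l" for i
  proof -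
    have "take (Suc i) (map f [0..<l]) = map f [0..<Suc i]"
      using that by (simp add: take_map take_upt del: upt_Suc)
    then have "sum_list (take (Suc i) (map f [0..<l])) = sum f (set [0..<Suc i])"
      by (simp only: interv_sum_list_conv_sum_set_nat set_upt)
    also have "set [0..<Suc i] = {..i}" by auto
    finally show ?thesis .
  qed
  then show ?thesis by (simp add: gmultinom_def gbinom_eq_ibinom)
qed

lemma A_lam_eq_A_int: "A_lam lam n k = of_int (A_int lam n k)"
  by (simp add: A_lam_def A_int_def A_fac_def gmultinom_map_upt)

lemma A_fac_scale:
  "A_fac lam (\<lambda>i. c * n i) k j i =
    ibinom (c * (\<Sum>t\<le>i. n (blockstart lam j + t)) - int i * k) (c * n (blockstart lam j + i) - k)"
  by (simp add: A_fac_def sum_distrib_left)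

lemma A_fac_first: "A_fac lam n k j 0 = ibinom (n (blockstart lam j)) k"
  by (simp add: A_fac_def ibinom_sym)

text \<open>Shows both entries as \<open>p\<close> times those of the factor at level
  \<open>t\<close> and index \<open>k\<close>, the form in which the ratio lemmas apply.\<close>

lemma A_fac_scale_Suc:
  fixes p :: int
  shows "A_fac lam (\<lambda>i. p ^ Suc t * n i) (p * k) j i =
    ibinom (p * (p ^ t * (\<Sum>t\<le>i. n (blockstart lam j + t)) - int i * k))
      (p * (p ^ t * n (blockstart lam j + i) - k))"
  unfolding A_fac_scale by (simp add: right_diff_distrib mult.assoc mult.left_commute)

section \<open>Divisibility and termwise congruences\<close>

text \<open>Each block is nonempty, and its leading factor has upper entry divisible by
  \<open>p ^ t\<close> and lower entry \<open>p ^ s * k\<close>.\<close>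

lemma A_int_dvd:
  fixes p :: int
  assumes p: "prime p" and lam: "\<forall>x\<in>set lam. 0 < x" and k: "\<not> p dvd k" and s: "s \<le> t"
  shows "p ^ ((t - s) * length lam) dvd A_int lam (\<lambda>i. p ^ t * n i) (p ^ s * k)"
proof -
  have "(\<Prod>j<length lam. p ^ (t - s)) dvd A_int lam (\<lambda>i. p ^ t * n i) (p ^ s * k)"
    unfolding A_int_def
  proof (rule prod_dvd_prod)
    fix j assume "j \<in> {..<length lam}"
    then have "0 < lam ! j" using lam by simp
    then have "A_fac lam (\<lambda>i. p ^ t * n i) (p ^ s * k) j 0 dvd
        (\<Prod>i<lam ! j. A_fac lam (\<lambda>i. p ^ t * n i) (p ^ s * k) j i)"
      by (intro dvd_prodI) auto
    moreover have "p ^ (t - s) dvd A_fac lam (\<lambda>i. p ^ t * n i) (p ^ s * k) j 0"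
      unfolding A_fac_first by (rule ibinom_prime_power_dvd[OF p _ k s]) simp
    ultimately show "p ^ (t - s) dvd (\<Prod>i<lam ! j. A_fac lam (\<lambda>i. p ^ t * n i) (p ^ s * k) j i)"
      by (rule dvd_trans[rotated])
  qed
  then show ?thesis by (simp add: power_mult)
qed

text \<open>\<open>s\<close> is the exponent of \<open>p\<close> in \<open>p * k\<close>, capped at
  \<open>r\<close>; the cap also covers \<open>k = 0\<close>.\<close>

lemma prime_power_split:
  fixes p k :: int
  assumes p: "prime p" and r: "1 \<le> r"
  obtains s where "1 \<le> s" "s \<le> r" "p ^ (s - 1) dvd k"
    "s = r \<or> (\<exists>k'. k = p ^ (s - 1) * k' \<and> \<not> p dvd k')"
proof -
  define s where "s = Suc (Max {m. m < r \<and> p ^ m dvd k})"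
  have ne: "{m. m < r \<and> p ^ m dvd k} \<noteq> {}" using r by (auto intro: exI[of _ 0])
  have fin: "finite {m. m < r \<and> p ^ m dvd k}" by simp
  from Max_in[OF fin ne] have s: "s - 1 < r" "p ^ (s - 1) dvd k" by (auto simp: s_def)
  from s(2) obtain k' where k': "k = p ^ (s - 1) * k'" by blast
  have "s = r" if "p dvd k'"
  proof (rule ccontr)
    assume "s \<noteq> r"
    then have "s < r" using s(1) by (simp add: s_def)
    moreover have "p ^ s dvd k"
    proof -
      have "p ^ (s - 1) * p dvd p ^ (s - 1) * k'" using that by (intro mult_dvd_mono) auto
      moreover have "p ^ (s - 1) * p = p ^ s" by (simp add: s_def)
      ultimately show ?thesis using k' by argo
    qed
    ultimately have "s \<le> Max {m. m < r \<and> p ^ m dvd k}" using fin by (intro Max_ge) auto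
    then show False by (simp add: s_def)
  qed
  then have "s = r \<or> (\<exists>k'. k = p ^ (s - 1) * k' \<and> \<not> p dvd k')" using k' by blast
  moreover have "1 \<le> s" "s \<le> r" using s(1) by (simp_all add: s_def)
  ultimately show thesis using that s(2) by blast
qed

lemma A_int_pred_dvd:
  fixes p :: int
  assumes p: "prime p" and lam: "\<forall>x\<in>set lam. 0 < x" "2 \<le> length lam"
    and s: "1 \<le> s" "s \<le> r" "s = r \<or> (\<exists>k'. k = p ^ (s - 1) * k' \<and> \<not> p dvd k')"
  shows "p ^ (2 * (r - s)) dvd A_int lam (\<lambda>i. p ^ (r - 1) * n i) k"
  using s(3)
proof
  assume "\<exists>k'. k = p ^ (s - 1) * k' \<and> \<not> p dvd k'"
  then obtain k' where k': "k = p ^ (s - 1) * k'" "\<not> p dvd k'" by blast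
  have "p ^ (2 * (r - s)) dvd p ^ ((r - 1 - (s - 1)) * length lam)"
    using lam(2) s by (intro le_imp_power_dvd) (simp add: mult.commute)
  also have "\<dots> dvd A_int lam (\<lambda>i. p ^ (r - 1) * n i) k"
    unfolding k'(1) using s by (intro A_int_dvd p lam k') auto
  finally show ?thesis .
qed simp

text \<open>The ratio of the terms is 1 modulo \<open>p ^ (2 * s)\<close>, and two blocks make the
  smaller term divisible by \<open>p ^ (2 * (r - s))\<close>.\<close>

lemma A_int_cong_square:
  fixes p :: int
  assumes p: "prime p" and lam: "\<forall>x\<in>set lam. 0 < x" "2 \<le> length lam"
    and s: "1 \<le> s" "s \<le> r" "p ^ (s - 1) dvd k" "odd p \<or> 2 \<le> s"
      "s = r \<or> (\<exists>k'. k = p ^ (s - 1) * k' \<and> \<not> p dvd k')"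
  shows "p ^ (2 * r) dvd A_int lam (\<lambda>i. p ^ r * n i) (p * k) - A_int lam (\<lambda>i. p ^ (r - 1) * n i) k"
proof -
  obtain t where r: "r = Suc t" using s by (cases r) auto
  \<comment> \<open>Every entry has this shape: \<open>y = 1\<close> in the lower one and
    \<open>y = int i\<close> in the upper one.\<close>
  have dvd: "p ^ s dvd p * (p ^ t * x - y * k)" for x y
  proof -
    have "p ^ (s - 1) dvd p ^ t" using s(2) r by (intro le_imp_power_dvd) simp
    then have "p ^ (s - 1) dvd p ^ t * x - y * k" using s(3) by (intro dvd_diff dvd_mult dvd_mult2)
    then have "p * p ^ (s - 1) dvd p * (p ^ t * x - y * k)" by simp
    then show ?thesis using s(1) by (cases s) auto
  qed
  have "pratio p (2 * s) (A_int lam (\<lambda>i. p ^ r * n i) (p * k)) (A_int lam (\<lambda>i. p ^ t * n i) k)"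
    unfolding A_int_def
  proof (intro pratio_prod p)
    fix j i
    show "pratio p (2 * s) (A_fac lam (\<lambda>i. p ^ r * n i) (p * k) j i) (A_fac lam (\<lambda>i. p ^ t * n i) k j i)"
      unfolding r A_fac_scale_Suc unfolding A_fac_scale
      by (intro pratio_ibinom_square p s(1,4)) (use dvd[of _ 1] dvd in auto)
  qed
  moreover have "p ^ (2 * (r - s)) dvd A_int lam (\<lambda>i. p ^ t * n i) k"
    using A_int_pred_dvd[OF p lam s(1,2,5)] r by simp
  ultimately have *: "p ^ (2 * s + 2 * (r - s)) dvd A_int lam (\<lambda>i. p ^ r * n i) (p * k) - A_int lam (\<lambda>i. p ^ t * n i) k"
    using p by (intro pratio_dvd_diff)
  have e: "2 * s + 2 * (r - s) = 2 * r" using s(2) by simp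
  have t: "r - 1 = t" using r by simp
  show ?thesis using * unfolding e t .
qed

text \<open>The exponents \<open>r + 2 * s\<close> of the ratio and \<open>2 * (r - s)\<close> of
  the smaller term add up to \<open>3 * r\<close>.\<close>

lemma A_int_cong_cube:
  fixes p :: int
  assumes p: "prime p" "5 \<le> p" and lam: "\<forall>x\<in>set lam. 0 < x" "2 \<le> length lam" "\<forall>x\<in>set lam. x \<le> 2"
    and r: "1 \<le> r"
  shows "p ^ (3 * r) dvd A_int lam (\<lambda>i. p ^ r * n i) (p * k) - A_int lam (\<lambda>i. p ^ (r - 1) * n i) k"
proof -
  obtain s where s: "1 \<le> s" "s \<le> r" "p ^ (s - 1) dvd k"
    "s = r \<or> (\<exists>k'. k = p ^ (s - 1) * k' \<and> \<not> p dvd k')"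
    using prime_power_split[OF p(1) r] by metis
  obtain t where r: "r = Suc t" using s by (cases r) auto
  have dvd: "p ^ s dvd p * (p ^ t * x - y * k)" for x y
  proof -
    have "p ^ (s - 1) dvd p ^ t" using s(2) r by (intro le_imp_power_dvd) simp
    then have "p ^ (s - 1) dvd p ^ t * x - y * k" using s(3) by (intro dvd_diff dvd_mult dvd_mult2)
    then have "p * p ^ (s - 1) dvd p * (p ^ t * x - y * k)" by simp
    then show ?thesis using s(1) by (cases s) auto
  qed
  have "pratio p (r + 2 * s) (A_int lam (\<lambda>i. p ^ r * n i) (p * k)) (A_int lam (\<lambda>i. p ^ t * n i) k)"
    unfolding A_int_def
  proof (intro pratio_prod p(1))
    fix j i assume ji: "j \<in> {..<length lam}" "i \<in> {..<lam ! j}"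
    then have "lam ! j \<le> 2" using lam(3) by simp
    then consider "i = 0" | "i = 1" using ji by force
    \<comment> \<open>Block length at most 2 enters here: for \<open>i = 0\<close> the upper entry
      is free of \<open>k\<close>, for \<open>i = 1\<close> the difference of the entries
      is.\<close>
    then have "p ^ r dvd p * (p ^ t * (\<Sum>t\<le>i. n (blockstart lam j + t)) - int i * k) \<or>
        p ^ r dvd p * (p ^ t * (\<Sum>t\<le>i. n (blockstart lam j + t)) - int i * k -
          (p ^ t * n (blockstart lam j + i) - k))"
      by cases (auto simp: r algebra_simps)
    then show "pratio p (r + 2 * s) (A_fac lam (\<lambda>i. p ^ r * n i) (p * k) j i) (A_fac lam (\<lambda>i. p ^ t * n i) k j i)"
      unfolding r A_fac_scale_Suc unfolding A_fac_scale
      by (intro pratio_ibinom_cube p) (use dvd[of _ 1] dvd s r in auto)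
  qed
  moreover have "p ^ (2 * (r - s)) dvd A_int lam (\<lambda>i. p ^ t * n i) k"
    using A_int_pred_dvd[OF p(1) lam(1,2) s(1,2,4)] r by simp
  ultimately have *: "p ^ (r + 2 * s + 2 * (r - s)) dvd A_int lam (\<lambda>i. p ^ r * n i) (p * k) - A_int lam (\<lambda>i. p ^ t * n i) k"
    using p by (intro pratio_dvd_diff)
  have e: "r + 2 * s + 2 * (r - s) = 3 * r" using s(2) by simp
  have t: "r - 1 = t" using r by simp
  show ?thesis using * unfolding e t .
qed

lemma prod_dvd_diff:
  fixes f g :: "'a \<Rightarrow> int"
  assumes "\<And>x. x \<in> A \<Longrightarrow> d dvd f x - g x"
  shows "d dvd prod f A - prod g A"
  unfolding cong_iff_dvd_diff[symmetric] using assms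
  by (intro cong_prod) (simp add: cong_iff_dvd_diff)

text \<open>For \<open>p = 2\<close> and odd \<open>k\<close> the leading factor of each block changes sign modulo \<open>4\<close>;
  the signs of two blocks cancel.\<close>

lemma A_int_cong_two:
  assumes lam: "\<forall>x\<in>set lam. 0 < x" "2 \<le> length lam" and r: "1 \<le> r"
  shows "2 ^ (2 * r) dvd A_int lam (\<lambda>i. 2 ^ r * n i) (2 * k) - A_int lam (\<lambda>i. 2 ^ (r - 1) * n i) k"
proof -
  obtain t where rt: "r = Suc t" using r by (cases r) auto
  have fac4: "4 dvd A_fac lam (\<lambda>i. 2 ^ r * n i) (2 * k) j i - A_fac lam (\<lambda>i. 2 ^ t * n i) k j i" for j i
    unfolding rt A_fac_scale_Suc unfolding A_fac_scale by (rule ibinom_double_mod_4)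
  \<comment> \<open>For \<open>r = 1\<close> the modulus is 4 and factorwise congruence suffices;
    even \<open>k\<close> forces \<open>2 \<le> s\<close>, as the square congruence requires; odd
    \<open>k\<close> needs the signs.\<close>
  consider "r = 1" | "2 \<le> r" "even k" | "2 \<le> r" "odd k" using r by linarith
  then show ?thesis
  proof cases
    case 1
    have "4 dvd A_int lam (\<lambda>i. 2 ^ r * n i) (2 * k) - A_int lam (\<lambda>i. 2 ^ t * n i) k"
      unfolding A_int_def by (intro prod_dvd_diff fac4)
    then show ?thesis using 1 rt by simp
  next
    case 2
    obtain s where s: "1 \<le> s" "s \<le> r" "2 ^ (s - 1) dvd k"
      "s = r \<or> (\<exists>k'. k = 2 ^ (s - 1) * k' \<and> \<not> 2 dvd k')"
      using prime_power_split[of 2 r k] r by auto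
    have "s \<noteq> 1" using s(4) 2 by auto
    then show ?thesis using s lam by (intro A_int_cong_square[where s = s]) auto
  next
    case 3
    define I where "I = (SIGMA j:{..<length lam}. {..<lam ! j})"
    define J where "J = I - {(0, 0)} - {(1, 0)}"
    have fin: "finite I" by (simp add: I_def)
    have "lam ! 0 \<in> set lam" "lam ! 1 \<in> set lam" using lam(2) by (auto intro!: nth_mem)
    then have "0 < lam ! 0" "0 < lam ! 1" using lam(1) by blast+
    then have in01: "(0, 0) \<in> I" "(1, 0) \<in> I - {(0, 0)}" using lam(2) by (auto simp: I_def)
    define F where "F = (\<lambda>n k. \<lambda>(j, i). A_fac lam n k j i)"
    have A: "A_int lam n k = F n k (0, 0) * F n k (1, 0) * prod (F n k) J" for n k
    proof -
      have "A_int lam n k = prod (F n k) I"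
        unfolding A_int_def F_def I_def by (rule prod.Sigma) auto
      also have "\<dots> = F n k (0, 0) * (F n k (1, 0) * prod (F n k) J)"
        unfolding J_def using fin in01 by (simp only: prod.remove finite_Diff)
      finally show ?thesis by (simp add: mult.assoc)
    qed
    have first: "\<exists>a b. F (\<lambda>i. 2 ^ r * n i) (2 * k) (j, 0) = 2 ^ t * a \<and>
        F (\<lambda>i. 2 ^ t * n i) k (j, 0) = 2 ^ t * b \<and> 4 dvd a + b" for j
    proof -
      have "1 \<le> t" using 3 rt by simp
      then obtain a b where "ibinom (2 * (2 ^ t * n (blockstart lam j))) (2 * k) = 2 ^ t * a"
        "ibinom (2 ^ t * n (blockstart lam j)) k = 2 ^ t * b" "4 dvd a + b"
        using ibinom_double_odd[of k "2 ^ t * n (blockstart lam j)" t] 3(2) by auto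
      then show ?thesis by (auto simp: F_def A_fac_first rt mult.assoc)
    qed
    obtain a b where ab: "F (\<lambda>i. 2 ^ r * n i) (2 * k) (0, 0) = 2 ^ t * a"
      "F (\<lambda>i. 2 ^ t * n i) k (0, 0) = 2 ^ t * b" "4 dvd a + b" using first by blast
    obtain a' b' where ab': "F (\<lambda>i. 2 ^ r * n i) (2 * k) (1, 0) = 2 ^ t * a'"
      "F (\<lambda>i. 2 ^ t * n i) k (1, 0) = 2 ^ t * b'" "4 dvd a' + b'" using first by blast
    define R where "R = prod (F (\<lambda>i. 2 ^ r * n i) (2 * k)) J"
    define R' where "R' = prod (F (\<lambda>i. 2 ^ t * n i) k) J"
    have "4 dvd R - R'" unfolding R_def R'_def
      by (rule prod_dvd_diff) (use fac4 in \<open>auto simp: F_def\<close>)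
    then have "4 dvd (a + b) * (a' * R) - (a' + b') * (b * R) + b * b' * (R - R')"
      using ab(3) ab'(3) by (simp only: dvd_add dvd_diff dvd_mult dvd_mult2)
    also have "\<dots> = a * a' * R - b * b' * R'" by (simp add: algebra_simps)
    finally have "2 ^ t * 2 ^ t * 4 dvd 2 ^ t * 2 ^ t * (a * a' * R - b * b' * R')"
      by (intro mult_dvd_mono) auto
    also have "2 ^ t * 2 ^ t * (a * a' * R - b * b' * R') =
        A_int lam (\<lambda>i. 2 ^ r * n i) (2 * k) - A_int lam (\<lambda>i. 2 ^ t * n i) k"
      unfolding A ab ab' by (simp add: R_def R'_def algebra_simps)
    also have "2 ^ t * 2 ^ t * 4 = (2::int) ^ (2 * r)"
      by (simp add: rt flip: power_mult_distrib power2_eq_square power_mult)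
    finally show ?thesis by (simp add: rt)
  qed
qed

lemma A_int_cong:
  fixes p :: int
  assumes p: "prime p" and lam: "\<forall>x\<in>set lam. 0 < x" "2 \<le> length lam" and r: "1 \<le> r"
  shows "p ^ (2 * r) dvd A_int lam (\<lambda>i. p ^ r * n i) (p * k) - A_int lam (\<lambda>i. p ^ (r - 1) * n i) k"
proof (cases "odd p")
  case True
  obtain s where "1 \<le> s" "s \<le> r" "p ^ (s - 1) dvd k"
    "s = r \<or> (\<exists>k'. k = p ^ (s - 1) * k' \<and> \<not> p dvd k')"
    using prime_power_split[OF p r] by metis
  then show ?thesis using True by (intro A_int_cong_square[where s = s] p lam) auto
next
  case False
  then have "2 = p" using p by (intro primes_dvd_imp_eq) auto
  then show ?thesis using A_int_cong_two[OF lam r] by simp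
qed

section \<open>Terms with index prime to \<open>p\<close> in the cube congruence\<close>

text \<open>\<open>k\<close> times a block, divided by \<open>p ^ t\<close> and written in
  \<open>K = k - 1\<close>; in this variable one level down means \<open>K div p\<close>.\<close>

definition blk :: "int \<Rightarrow> int \<Rightarrow> int \<Rightarrow> nat \<Rightarrow> nat \<Rightarrow> int \<Rightarrow> int" where
  "blk p a b l t K = a * ibinom (p ^ t * a - 1) K *
     (if l = 2 then ibinom (p ^ t * (a + b) - K - 1) (p ^ t * a) else 1)"

text \<open>The first coefficient produces the sign by \<open>ibinom_pred_cong\<close>. In the
  second the upper entry has last digit \<open>p - 1 - K mod p\<close>, dropped by
  \<open>ibinom_floor_cong\<close>.\<close>

lemma blk_step:
  fixes p :: int
  assumes p: "prime p" "odd p"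
  shows "p ^ Suc t dvd blk p a b l (Suc t) K -
    (if even (K + K div p) then 1 else -1) * blk p a b l t (K div p)"
proof -
  have p1: "1 < p" using p(1) by (rule prime_gt_1_int)
  define u where "u = K div p"
  define e :: int where "e = (if even (K + u) then 1 else -1)"
  define x where "x = ibinom (p ^ Suc t * a - 1) K"
  define x' where "x' = ibinom (p ^ t * a - 1) u"
  define y where "y = (if l = 2 then ibinom (p ^ Suc t * (a + b) - K - 1) (p ^ Suc t * a) else 1)"
  define y' where "y' = (if l = 2 then ibinom (p ^ t * (a + b) - u - 1) (p ^ t * a) else 1)"
  have 1: "p ^ Suc t dvd x - e * x'"
    using ibinom_pred_cong[OF p, of "Suc t" "p ^ t * a" K]
    by (simp add: x_def x'_def e_def u_def mult.assoc)
  have K: "K = p * u + K mod p" "0 \<le> K mod p" "K mod p < p" using p1 by (auto simp: u_def)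
  have e1: "p ^ Suc t * (a + b) - K - 1 = p * (p ^ t * (a + b) - u - 1) + (p - 1 - K mod p)"
    using K(1) by (simp add: algebra_simps)
  have e2: "p ^ Suc t * a = p * (p ^ t * a)" by simp
  have "p ^ Suc t dvd ibinom (p * (p ^ t * (a + b) - u - 1) + (p - 1 - K mod p)) (p * (p ^ t * a))
      - ibinom (p ^ t * (a + b) - u - 1) (p ^ t * a)"
    using K(2,3) by (intro ibinom_floor_cong[OF p]) auto
  then have 2: "p ^ Suc t dvd y - y'"
    unfolding y_def y'_def e1 e2 by auto
  have "p ^ Suc t dvd a * y * (x - e * x') + a * e * x' * (y - y')"
    using 1 2 by (simp only: dvd_add dvd_mult)
  also have "a * y * (x - e * x') + a * e * x' * (y - y') = a * x * y - e * (a * x' * y')"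
    by (simp add: algebra_simps)
  finally show ?thesis
    by (simp only: blk_def x_def x'_def y_def y'_def e_def u_def)
qed

lemma blk_eq:
  assumes "l = 1 \<or> l = 2"
  shows "k * (\<Prod>i<l. A_fac lam (\<lambda>i. p ^ t * n i) k j i) =
    p ^ t * blk p (n (blockstart lam j)) (n (Suc (blockstart lam j))) l t (k - 1)"
proof -
  define a where "a = n (blockstart lam j)"
  define b where "b = n (Suc (blockstart lam j))"
  have 0: "k * A_fac lam (\<lambda>i. p ^ t * n i) k j 0 = p ^ t * (a * ibinom (p ^ t * a - 1) (k - 1))"
    unfolding A_fac_first using ibinom_absorb[of k "p ^ t * a"] by (simp add: a_def mult.assoc)
  have 1: "A_fac lam (\<lambda>i. p ^ t * n i) k j (Suc 0) = ibinom (p ^ t * (a + b) - k) (p ^ t * a)"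
    using ibinom_sym[of "p ^ t * (a + b) - k" "p ^ t * a"]
    unfolding A_fac_scale by (simp add: a_def b_def algebra_simps)
  from assms show ?thesis
  proof
    assume "l = 1"
    then show ?thesis using 0 by (simp add: blk_def a_def)
  next
    assume "l = 2"
    then have "(\<Prod>i<l. A_fac lam (\<lambda>i. p ^ t * n i) k j i) =
        A_fac lam (\<lambda>i. p ^ t * n i) k j 0 * ibinom (p ^ t * (a + b) - k) (p ^ t * a)"
      by (simp add: numeral_2_eq_2 1)
    then have "k * (\<Prod>i<l. A_fac lam (\<lambda>i. p ^ t * n i) k j i) =
        (k * A_fac lam (\<lambda>i. p ^ t * n i) k j 0) * ibinom (p ^ t * (a + b) - k) (p ^ t * a)"
      by simp
    also have "\<dots> = p ^ t * blk p a b l t (k - 1)"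
      unfolding 0 using \<open>l = 2\<close> by (simp add: blk_def)
    finally show ?thesis by (simp add: a_def b_def)
  qed
qed

text \<open>Integer form of \<open>eps powi k\<close>, which depends only on the parity of
  \<open>k\<close> because \<open>eps\<close> is 1 or -1.\<close>

definition altsign :: "int \<Rightarrow> int \<Rightarrow> int" where
  "altsign eps k = (if even k then 1 else eps)"

lemma altsign_powi:
  assumes "eps \<in> {-1, 1}"
  shows "real_of_int eps powi k = of_int (altsign eps k)"
  using assms by (auto simp: altsign_def power_int_minus_one_minus power_int_minus_left)

lemma sum_altsign_invsq_block:
  assumes p: "prime p" "5 \<le> p" and s: "s \<le> r" and eps: "eps \<in> {-1, 1}"
  shows "p ^ s dvd (\<Sum>K\<in>{p ^ s * u..<p ^ s * (u + 1)}. altsign eps (K + 1) * invsq p r (K + 1))"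
proof (cases "s = 0")
  case False
  then have s1: "1 \<le> s" by simp
  have "(\<Sum>K\<in>{p ^ s * u..<p ^ s * (u + 1)}. altsign eps (K + 1) * invsq p r (K + 1)) =
      (\<Sum>k\<in>{p ^ s * u<..p ^ s * (u + 1)}. altsign eps k * invsq p r k)"
    by (rule sum.reindex_bij_witness[of _ "\<lambda>k. k - 1" "\<lambda>K. K + 1"]) auto
  moreover have "p ^ s dvd (\<Sum>k\<in>{p ^ s * u<..p ^ s * (u + 1)}. altsign eps k * invsq p r k)"
    using eps sum_invsq_block[OF p s1 s, of u] sum_alt_invsq_block[OF p s1, of r u]
    by (auto simp: altsign_def)
  ultimately show ?thesis by simp
qed simp

text \<open>Up to multiples of \<open>p ^ (3 * r)\<close> a term is
  \<open>p ^ (2 * r) * W K * G r K\<close> with \<open>K = k - 1\<close>; the weighted block sum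
  yields the last \<open>p ^ r\<close>.\<close>

lemma sum_A_int_units_two:
  fixes p :: int
  assumes p: "prime p" "5 \<le> p" and lam: "\<forall>x\<in>set lam. 0 < x" "length lam = 2" "\<forall>x\<in>set lam. x \<le> 2"
    and M: "0 \<le> M" and eps: "eps \<in> {-1, 1}"
  shows "p ^ (3 * r) dvd (\<Sum>k | k \<in> {- (p ^ r * M)<..p ^ r * M} \<and> \<not> p dvd k.
      altsign eps k * A_int lam (\<lambda>i. p ^ r * n i) k)"
proof -
  have p0: "0 < p" using p by simp
  have odd: "odd p" using prime_ge_5_not_dvd[OF p] by simp
  define g where "g = (\<lambda>j t K. blk p (n (blockstart lam j)) (n (Suc (blockstart lam j))) (lam ! j) t K)"
  define G where "G = (\<lambda>t K. g 0 t K * g 1 t K)"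
  define W where "W = (\<lambda>K. altsign eps (K + 1) * invsq p r (K + 1))"
  define I where "I = {- (p ^ r * M)<..p ^ r * M}"
  have lamj: "lam ! j = 1 \<or> lam ! j = 2" if "j < 2" for j
  proof -
    have "lam ! j \<in> set lam" using that lam(2) by simp
    then have "0 < lam ! j" "lam ! j \<le> 2" using lam by auto
    then show ?thesis by linarith
  qed
  have A: "k ^ 2 * A_int lam (\<lambda>i. p ^ r * n i) k = p ^ (2 * r) * G r (k - 1)" for k
  proof -
    have "k ^ 2 * A_int lam (\<lambda>i. p ^ r * n i) k =
       (k * (\<Prod>i<lam ! 0. A_fac lam (\<lambda>i. p ^ r * n i) k 0 i)) *
       (k * (\<Prod>i<lam ! 1. A_fac lam (\<lambda>i. p ^ r * n i) k 1 i))"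
      unfolding A_int_def lam(2) by (simp add: numeral_2_eq_2)
    also have "\<dots> = (p ^ r * g 0 r (k - 1)) * (p ^ r * g 1 r (k - 1))"
      unfolding g_def using blk_eq[OF lamj[of 0]] blk_eq[OF lamj[of 1]] by simp
    also have "\<dots> = p ^ (2 * r) * G r (k - 1)"
      by (simp add: G_def mult_2 power_add)
    finally show ?thesis .
  qed
  \<comment> \<open>Two blocks already give \<open>p ^ (2 * r)\<close>, so \<open>invsq\<close> need
    invert \<open>k ^ 2\<close> only modulo \<open>p ^ r\<close>.\<close>
  have termwise: "p ^ (3 * r) dvd altsign eps k * A_int lam (\<lambda>i. p ^ r * n i) k -
      p ^ (2 * r) * (W (k - 1) * G r (k - 1))" if k: "\<not> p dvd k" for k
  proof -
    have "p ^ ((r - 0) * length lam) dvd A_int lam (\<lambda>i. p ^ r * n i) (p ^ 0 * k)"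
      using k by (intro A_int_dvd p lam) auto
    then have "p ^ (2 * r) dvd A_int lam (\<lambda>i. p ^ r * n i) k"
      using lam(2) by (simp add: mult.commute[of r])
    then obtain q where q: "A_int lam (\<lambda>i. p ^ r * n i) k = p ^ (2 * r) * q" by (elim dvdE)
    have "p ^ (2 * r) * (k ^ 2 * q) = p ^ (2 * r) * G r (k - 1)"
      using A[of k] unfolding q by (simp add: mult.left_commute)
    then have kq: "k ^ 2 * q = G r (k - 1)" using p0 by simp
    have "p ^ r dvd - altsign eps k * q * (k ^ 2 * invsq p r k - 1)"
      using invsq_inverse[OF p(1) k] by (rule dvd_mult)
    also have "\<dots> = altsign eps k * q - W (k - 1) * G r (k - 1)"
      unfolding kq[symmetric] by (simp add: W_def algebra_simps)
    finally have "p ^ (2 * r) * p ^ r dvd p ^ (2 * r) * (altsign eps k * q - W (k - 1) * G r (k - 1))"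
      by (rule mult_dvd_mono[OF dvd_refl])
    moreover have "p ^ (2 * r) * p ^ r = p ^ (3 * r)" by (simp flip: power_add)
    ultimately show ?thesis unfolding q by (simp add: algebra_simps)
  qed
  have "p ^ r dvd (\<Sum>K\<in>{p ^ r * - M..<p ^ r * M}. W K * G r K)"
  proof (rule weighted_sum_dvd)
    fix i K
    define u where "u = K div p"
    define e :: int where "e = (if even (K + u) then 1 else -1)"
    \<comment> \<open>Both blocks change by the same sign, so their product satisfies the recursion
      without sign.\<close>
    have ee: "e * e = 1" by (simp add: e_def)
    have st: "p ^ Suc i dvd g j (Suc i) K - e * g j i u" for j
      unfolding g_def e_def u_def by (rule blk_step[OF p(1) odd])
    have "p ^ Suc i dvd (g 0 (Suc i) K - e * g 0 i u) * g 1 (Suc i) K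
        + (g 1 (Suc i) K - e * g 1 i u) * (e * g 0 i u)"
      using st by (simp only: dvd_add dvd_mult2)
    also have "\<dots> = g 0 (Suc i) K * g 1 (Suc i) K - e * e * (g 0 i u * g 1 i u)"
      by (simp add: algebra_simps)
    finally show "p ^ Suc i dvd G (Suc i) K - G i (K div p)"
      unfolding ee by (simp add: G_def u_def)
  next
    fix s u assume "s \<le> r"
    then show "p ^ s dvd (\<Sum>K\<in>{p ^ s * u..<p ^ s * (u + 1)}. W K)"
      unfolding W_def by (intro sum_altsign_invsq_block p eps)
  qed (use p0 M in auto)
  also have "(\<Sum>K\<in>{p ^ r * - M..<p ^ r * M}. W K * G r K) = (\<Sum>k\<in>I. W (k - 1) * G r (k - 1))"
    by (rule sum.reindex_bij_witness[of _ "\<lambda>k. k - 1" "\<lambda>K. K + 1"]) (auto simp: I_def)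
  \<comment> \<open>Multiples of \<open>p\<close> have weight 0 by the choice of
    \<open>invsq\<close>.\<close>
  also have "\<dots> = (\<Sum>k | k \<in> I \<and> \<not> p dvd k. W (k - 1) * G r (k - 1))"
    by (rule sum.mono_neutral_right) (auto simp: I_def W_def invsq_def)
  finally have "p ^ (2 * r) * p ^ r dvd p ^ (2 * r) * (\<Sum>k | k \<in> I \<and> \<not> p dvd k. W (k - 1) * G r (k - 1))"
    by (rule mult_dvd_mono[OF dvd_refl])
  moreover have "p ^ (2 * r) * p ^ r = p ^ (3 * r)" by (simp flip: power_add)
  ultimately have 1: "p ^ (3 * r) dvd (\<Sum>k | k \<in> I \<and> \<not> p dvd k. p ^ (2 * r) * (W (k - 1) * G r (k - 1)))"
    by (simp add: sum_distrib_left)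
  have "p ^ (3 * r) dvd (\<Sum>k | k \<in> I \<and> \<not> p dvd k. altsign eps k * A_int lam (\<lambda>i. p ^ r * n i) k) -
      (\<Sum>k | k \<in> I \<and> \<not> p dvd k. p ^ (2 * r) * (W (k - 1) * G r (k - 1)))"
    by (rule sum_dvd_diff) (use termwise in auto)
  then show ?thesis using 1 unfolding I_def by (rule dvd_of_diff)
qed

text \<open>With three or more blocks each term is divisible by \<open>p ^ (3 * r)\<close> on its
  own; cancellation in the sum is needed only for two.\<close>

lemma sum_A_int_units:
  fixes p :: int
  assumes p: "prime p" "5 \<le> p" and lam: "\<forall>x\<in>set lam. 0 < x" "2 \<le> length lam" "\<forall>x\<in>set lam. x \<le> 2"
    and M: "0 \<le> M" and eps: "eps \<in> {-1, 1}"
  shows "p ^ (3 * r) dvd (\<Sum>k | k \<in> {- (p ^ r * M)<..p ^ r * M} \<and> \<not> p dvd k.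
      altsign eps k * A_int lam (\<lambda>i. p ^ r * n i) k)"
proof (cases "length lam = 2")
  case True
  then show ?thesis using assms by (intro sum_A_int_units_two) auto
next
  case False
  then have 3: "3 \<le> length lam" using lam(2) by simp
  show ?thesis
  proof (intro dvd_sum dvd_mult)
    fix k assume "k \<in> {k. k \<in> {- (p ^ r * M)<..p ^ r * M} \<and> \<not> p dvd k}"
    then have "p ^ ((r - 0) * length lam) dvd A_int lam (\<lambda>i. p ^ r * n i) (p ^ 0 * k)"
      by (intro A_int_dvd p lam) auto
    moreover have "p ^ (3 * r) dvd p ^ ((r - 0) * length lam)"
      using 3 by (intro le_imp_power_dvd) (simp add: mult.commute)
    ultimately show "p ^ (3 * r) dvd A_int lam (\<lambda>i. p ^ r * n i) k"
      using dvd_trans by auto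
  qed
qed

section \<open>Assembling the sums\<close>

lemma A_lam_eps_eq:
  assumes eps: "eps \<in> {-1, 1}" and T: "finite T" "A_support lam n \<subseteq> T"
  shows "A_lam_eps lam eps n = of_int (\<Sum>k\<in>T. altsign eps k * A_int lam n k)"
proof -
  have "A_lam_eps lam eps n = (\<Sum>k\<in>T. real_of_int eps powi k * A_lam lam n k)"
    unfolding A_lam_eps_def
    by (rule sum.mono_neutral_left) (use T in \<open>auto simp: A_support_def\<close>)
  then show ?thesis by (simp add: altsign_powi[OF eps] A_lam_eq_A_int)
qed

text \<open>The two sums are extended to intervals in ratio \<open>p\<close>, so that the multiples
  of \<open>p\<close> in the larger are exactly \<open>p\<close> times the smaller. The end points
  are multiples of \<open>p ^ r\<close>, as the block summation requires.\<close>

lemma A_lam_eps_diff: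
  fixes p :: int
  assumes eps: "eps \<in> {-1, 1}" and p: "prime p" "odd p \<or> eps = 1" and r: "1 \<le> r"
    and fin: "finite (A_support lam (\<lambda>i. p ^ r * n i))" "finite (A_support lam (\<lambda>i. p ^ (r - 1) * n i))"
    and termwise: "\<And>k. d dvd A_int lam (\<lambda>i. p ^ r * n i) (p * k) - A_int lam (\<lambda>i. p ^ (r - 1) * n i) k"
    and units: "\<And>M. 0 \<le> M \<Longrightarrow> d dvd (\<Sum>k | k \<in> {- (p ^ r * M)<..p ^ r * M} \<and> \<not> p dvd k.
      altsign eps k * A_int lam (\<lambda>i. p ^ r * n i) k)"
  shows "\<exists>z. A_lam_eps lam eps (\<lambda>i. p ^ r * n i) - A_lam_eps lam eps (\<lambda>i. p ^ (r - 1) * n i) = of_int (d * z)"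
proof -
  obtain t where t: "r = Suc t" using r by (cases r) auto
  then have t': "r - 1 = t" by simp
  have p1: "1 < p" using p(1) by (rule prime_gt_1_int)
  define S where "S = A_support lam (\<lambda>i. p ^ r * n i) \<union> A_support lam (\<lambda>i. p ^ (r - 1) * n i)"
  have finS: "finite S" using fin by (simp add: S_def)
  \<comment> \<open>Exceeds every absolute value in both supports; inserting 0 keeps the maximum
    defined for empty supports.\<close>
  define M where "M = Max (insert 0 (abs ` S)) + 1"
  have M: "\<bar>k\<bar> < M" if "k \<in> S" for k
    using that finS Max_ge[of "insert 0 (abs ` S)" "\<bar>k\<bar>"] by (simp add: M_def)
  have M0: "0 < M" using finS Max_ge[of "insert 0 (abs ` S)" 0] by (simp add: M_def)
  have sub: "S \<subseteq> {- (p ^ m * M)<..p ^ m * M}" for m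
  proof
    fix k assume "k \<in> S"
    then have "\<bar>k\<bar> < M" by (rule M)
    also have "M \<le> p ^ m * M" using M0 p1 by (simp add: mult_le_cancel_right1)
    finally show "k \<in> {- (p ^ m * M)<..p ^ m * M}" by auto
  qed
  define f where "f = (\<lambda>k. altsign eps k * A_int lam (\<lambda>i. p ^ r * n i) k)"
  define f' where "f' = (\<lambda>k. altsign eps k * A_int lam (\<lambda>i. p ^ t * n i) k)"
  define L where "L = p ^ t * M"
  have pL: "p ^ r * M = p * L" by (simp add: L_def t)
  have 1: "A_lam_eps lam eps (\<lambda>i. p ^ r * n i) = of_int (\<Sum>k\<in>{- (p * L)<..p * L}. f k)"
    unfolding f_def using sub[of r] by (intro A_lam_eps_eq eps) (auto simp: S_def pL)
  have 2: "A_lam_eps lam eps (\<lambda>i. p ^ (r - 1) * n i) = of_int (\<Sum>k\<in>{- L<..L}. f' k)"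
    using sub[of t] unfolding f'_def L_def S_def t' by (intro A_lam_eps_eq eps) auto
  have 3: "(\<Sum>k\<in>{- (p * L)<..p * L}. f k) =
      (\<Sum>k | k \<in> {- (p * L)<..p * L} \<and> p dvd k. f k) + (\<Sum>k | k \<in> {- (p * L)<..p * L} \<and> \<not> p dvd k. f k)"
    using sum.Int_Diff[of "{- (p * L)<..p * L}" f "{k. p dvd k}"]
    by (simp add: Int_def set_diff_eq)
  have 4: "{k. k \<in> {- (p * L)<..p * L} \<and> p dvd k} = (*) p ` {- L<..L}"
  proof -
    have iff: "p * k \<in> {- (p * L)<..p * L} \<longleftrightarrow> k \<in> {- L<..L}" for k
      using p1 mult_less_cancel_left_pos[of p "- L" k] by simp
    show ?thesis
    proof (intro equalityI subsetI)
      fix x assume x: "x \<in> {k. k \<in> {- (p * L)<..p * L} \<and> p dvd k}"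
      then obtain k where k: "x = p * k" by blast
      with x iff have "k \<in> {- L<..L}" by blast
      with k show "x \<in> (*) p ` {- L<..L}" by blast
    next
      fix x assume "x \<in> (*) p ` {- L<..L}"
      then obtain k where "x = p * k" "k \<in> {- L<..L}" by blast
      with iff show "x \<in> {k. k \<in> {- (p * L)<..p * L} \<and> p dvd k}" by simp
    qed
  qed
  have 5: "(\<Sum>k\<in>(*) p ` {- L<..L}. f k) = (\<Sum>k\<in>{- L<..L}. f (p * k))"
    using p1 by (subst sum.reindex) (auto simp: inj_on_def)
  have 6: "d dvd (\<Sum>k\<in>{- L<..L}. f (p * k)) - (\<Sum>k\<in>{- L<..L}. f' k)"
  proof (rule sum_dvd_diff)
    fix k
    \<comment> \<open>For odd \<open>p\<close> the parities of \<open>p * k\<close> and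
      \<open>k\<close> agree; for \<open>eps = 1\<close> all signs are 1.\<close>
    have "altsign eps (p * k) = altsign eps k" using p(2) by (auto simp: altsign_def)
    then have "f (p * k) - f' k = altsign eps k *
        (A_int lam (\<lambda>i. p ^ r * n i) (p * k) - A_int lam (\<lambda>i. p ^ (r - 1) * n i) k)"
      by (simp add: f_def f'_def t right_diff_distrib)
    then show "d dvd f (p * k) - f' k" using termwise[of k] by simp
  qed
  have 7: "d dvd (\<Sum>k | k \<in> {- (p * L)<..p * L} \<and> \<not> p dvd k. f k)"
    using units[of M] M0 unfolding f_def pL by simp
  from dvd_add[OF 6 7]
  have "d dvd (\<Sum>k\<in>{- (p * L)<..p * L}. f k) - (\<Sum>k\<in>{- L<..L}. f' k)"
    unfolding 3 4 5 diff_add_eq .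
  then obtain z where "(\<Sum>k\<in>{- (p * L)<..p * L}. f k) - (\<Sum>k\<in>{- L<..L}. f' k) = d * z"
    by (elim dvdE)
  then show ?thesis unfolding 1 2 of_int_diff[symmetric] by (intro exI[of _ z]) (simp only:)
qed

theorem theorem3p2:
  fixes lam :: "nat list" and eps :: int and n :: "nat \<Rightarrow> int"
  assumes eps: "eps \<in> {-1, 1}"
    and lam_pos: "\<forall>x\<in>set lam. x > 0"
    and fin: "finite (A_support lam n)"
  shows
    "(length lam \<ge> 2 \<longrightarrow>
       (\<forall>(p::nat) (r::nat). prime p \<and> (p \<ge> 3 \<or> eps = 1) \<and> r \<ge> 1
          \<and> finite (A_support lam (\<lambda>i. int p ^ r * n i))
          \<and> finite (A_support lam (\<lambda>i. int p ^ (r - 1) * n i))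
        \<longrightarrow> (A_lam_eps lam eps (\<lambda>i. int p ^ r * n i)
             - A_lam_eps lam eps (\<lambda>i. int p ^ (r - 1) * n i)) / real p ^ (2 * r) \<in> \<int>))
     \<and>
     (length lam \<ge> 2 \<and> (\<forall>x\<in>set lam. x \<le> 2) \<longrightarrow>
       (\<forall>(p::nat) (r::nat). prime p \<and> p \<ge> 5 \<and> r \<ge> 1
          \<and> finite (A_support lam (\<lambda>i. int p ^ r * n i))
          \<and> finite (A_support lam (\<lambda>i. int p ^ (r - 1) * n i))
        \<longrightarrow> (A_lam_eps lam eps (\<lambda>i. int p ^ r * n i)
             - A_lam_eps lam eps (\<lambda>i. int p ^ (r - 1) * n i)) / real p ^ (3 * r) \<in> \<int>))"
proof (intro conjI impI allI; elim conjE)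
  have int_quotient: "x / real p ^ m \<in> \<int>" if ex: "\<exists>z. x = real_of_int (int p ^ m * z)" and pr: "prime p" for x p m
  proof -
    obtain z where "x = real_of_int (int p ^ m * z)" using ex by blast
    then have "x / real p ^ m = of_int z" using prime_gt_0_nat[OF pr] by simp
    then show ?thesis by simp
  qed
  {
    fix p r :: nat
    assume len: "2 \<le> length lam" and p: "prime p" "3 \<le> p \<or> eps = 1" and r: "1 \<le> r"
      and fin: "finite (A_support lam (\<lambda>i. int p ^ r * n i))" "finite (A_support lam (\<lambda>i. int p ^ (r - 1) * n i))"
    have pr: "prime (int p)" using p by simp
    have odd: "odd (int p) \<or> eps = 1"
      using p primes_dvd_imp_eq[of 2 p] by auto
    show "(A_lam_eps lam eps (\<lambda>i. int p ^ r * n i)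
             - A_lam_eps lam eps (\<lambda>i. int p ^ (r - 1) * n i)) / real p ^ (2 * r) \<in> \<int>"
    proof (rule int_quotient[OF A_lam_eps_diff[OF eps pr odd r fin] p(1)])
      show "int p ^ (2 * r) dvd A_int lam (\<lambda>i. int p ^ r * n i) (int p * k) - A_int lam (\<lambda>i. int p ^ (r - 1) * n i) k" for k
        by (rule A_int_cong[OF pr lam_pos len r])
      \<comment> \<open>No cancellation between terms is needed: each of at least two blocks
        contributes \<open>p ^ r\<close>.\<close>
      show "int p ^ (2 * r) dvd (\<Sum>k | k \<in> {- (int p ^ r * M)<..int p ^ r * M} \<and> \<not> int p dvd k.
          altsign eps k * A_int lam (\<lambda>i. int p ^ r * n i) k)" for M
      proof (intro dvd_sum dvd_mult)
        fix k assume "k \<in> {k. k \<in> {- (int p ^ r * M)<..int p ^ r * M} \<and> \<not> int p dvd k}"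
        then have "int p ^ ((r - 0) * length lam) dvd A_int lam (\<lambda>i. int p ^ r * n i) (int p ^ 0 * k)"
          by (intro A_int_dvd pr lam_pos) auto
        moreover have "int p ^ (2 * r) dvd int p ^ ((r - 0) * length lam)"
          using len by (intro le_imp_power_dvd) (simp add: mult.commute)
        ultimately show "int p ^ (2 * r) dvd A_int lam (\<lambda>i. int p ^ r * n i) k"
          using dvd_trans by auto
      qed
    qed
  next
    fix p r :: nat
    assume len: "2 \<le> length lam" "\<forall>x\<in>set lam. x \<le> 2" and p: "prime p" "5 \<le> p" and r: "1 \<le> r"
      and fin: "finite (A_support lam (\<lambda>i. int p ^ r * n i))" "finite (A_support lam (\<lambda>i. int p ^ (r - 1) * n i))"
    have pr: "prime (int p)" "5 \<le> int p" using p by simp_all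
    have odd: "odd (int p) \<or> eps = 1" using prime_ge_5_not_dvd(1)[OF pr] ..
    show "(A_lam_eps lam eps (\<lambda>i. int p ^ r * n i)
             - A_lam_eps lam eps (\<lambda>i. int p ^ (r - 1) * n i)) / real p ^ (3 * r) \<in> \<int>"
      by (rule int_quotient[OF A_lam_eps_diff[OF eps pr(1) odd r fin
            A_int_cong_cube[OF pr lam_pos len r] sum_A_int_units[OF pr lam_pos len _ eps]] p(1)])
  }
qed

end
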